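(* Let $\xi_1,\dots,\xi_n$ be independent random variables with values in a measurable space $(\mathbb{X},\mathcal{X})$, all having the same distribution $\mathbb{P}$. Let $\mathcal{C}\subset\mathcal{X}$ be a countable family of measurable sets which is a VC class of index $d\ge 1$, and assume that $n\ge d$. Put $$Z=\sup_{C\in\mathcal{C}}\left|\sum_{i=1}^n\left(\mathbf{1}_C(\xi_i)-\mathbb{P}(C)\right)\right|.$$ Then for every real $x>0$, $$\Pr\left(Z\ \ge\ 2052\sqrt{dn}+2\sqrt{nx}+3203\,x\right)\ \le\ 2e^{-x}.$$
   Context: $\mathbf{1}_C$ denotes the indicator function of $C$. A class $\mathcal{C}$ of subsets of $\mathbb{X}$ shatters a finite set $A\subset\mathbb{X}$ if for every subset $B\subset A$ there is $C\in\mathcal{C}$ with $B=A\cap C$. $\mathcal{C}$ is a VC (Vapnik--Chervonenkis) class of index $d$ if $d$ is the largest (finite) number such that $\mathcal{C}$ shatters at least one set of cardinality $d$. *)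

theory Defs
  imports "HOL-Probability.Probability"
begin

definition shatters :: "'a set set \<Rightarrow> 'a set \<Rightarrow> bool" where
  "shatters \<C> A \<longleftrightarrow> (\<forall>B\<subseteq>A. \<exists>C\<in>\<C>. B = A \<inter> C)"

text \<open>Only finite sets \<open>A\<close> are tested: \<open>card\<close> is \<open>0\<close> on infinite sets.\<close>

definition VC_class_of_index :: "'a set \<Rightarrow> 'a set set \<Rightarrow> nat \<Rightarrow> bool" where
  "VC_class_of_index X \<C> d \<longleftrightarrow>
     (\<exists>A\<subseteq>X. finite A \<and> card A = d \<and> shatters \<C> A) \<and>
     (\<forall>k. (\<exists>A\<subseteq>X. finite A \<and> card A = k \<and> shatters \<C> A) \<longrightarrow> k \<le> d)"

end

theory Submission
  imports Defs
begin

text \<open>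
  The deviation of \<open>Z\<close> splits into its fluctuation around its mean and the size of that mean.
  Replacing one observation moves \<open>Z\<close> by at most \<open>1\<close>, so the bounded differences inequality
  \<open>McDiarmid_inequality\<close> gives \<open>Pr (Z \<ge> E Z + t) \<le> exp (- 2 t\<^sup>2 / n)\<close>. With
  \<open>t = 2 sqrt (n x)\<close> this is \<open>exp (- 8 x)\<close>. What is left is a bound \<open>E Z \<le> 24 sqrt (d n)\<close>
  without a logarithmic factor.

  Symmetrization (lemma \<open>symmetrization\<close>) replaces the centred sums by Rademacher sums
  \<open>\<Sum>i. 2 \<epsilon>\<^sub>i 1\<^sub>C(\<xi>\<^sub>i)\<close>. For fixed observations the class then matters only through the family
  of index sets \<open>{i. \<xi>\<^sub>i \<in> C}\<close>, a finite family of subsets of \<open>{1..n}\<close> that shatters no set of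
  more than \<open>d\<close> indices, and the problem has become one about finite sets.

  The logarithm is avoided by chaining (lemma \<open>sign_mean_sup_le\<close>). Take nets of the family at the
  Hamming scales \<open>n / 4 ^ k\<close>. The link from level \<open>k + 1\<close> to level \<open>k\<close> is a maximum of finitely
  many sub-Gaussian sums of variance at most \<open>n / 4 ^ k\<close>, and by \<open>ln_card_packing_le\<close> the
  logarithm of their number is of order \<open>d (k + 1)\<close>. Hence the link costs of order
  \<open>2 ^ (- k) (k + 1) sqrt (d n)\<close>, which is summable in \<open>k\<close>.

  The packing bound rests on the Sauer--Shelah lemma: members of the family that are far apart in
  Hamming distance remain distinct when traced on a few well chosen indices, and on few indices
  there are only polynomially many traces.
\<close>

section \<open>Shattering and packing numbers\<close>

lemma shatters_mono: "F \<subseteq> G \<Longrightarrow> shatters F S \<Longrightarrow> shatters G S"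
  unfolding shatters_def by (meson subsetD)

text \<open>
  Pajor's form of the Sauer--Shelah lemma, by induction on the ground set. Split \<open>F\<close> by membership
  of the new point \<open>x\<close> and forget \<open>x\<close>. Sets shattered by either part are shattered by \<open>F\<close>, and
  those shattered by both parts stay shattered after adding \<open>x\<close>, so they are counted twice on the
  right as well.
\<close>

lemma card_le_card_shattered:
  fixes Q :: "'a set"
  assumes "finite Q" "F \<subseteq> Pow Q"
  shows "card F \<le> card {S \<in> Pow Q. shatters F S}"
  using assms
proof (induction Q arbitrary: F rule: finite_induct)
  case empty
  then have "F = {} \<or> F = {{}}" by auto
  moreover have "{S \<in> Pow {}. shatters {{} :: 'a set} S} = {{}}"
  proof -
    have "shatters {{} :: 'a set} {}" by (simp add: shatters_def)
    then show ?thesis by (auto simp only: Pow_empty)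
  qed
  ultimately show ?case by (elim disjE) simp_all
next
  case (insert x Q)
  define F0 where "F0 = {A \<in> F. x \<notin> A}"
  define F1 where "F1 = (\<lambda>A. A - {x}) ` {A \<in> F. x \<in> A}"
  define Sh where "Sh = (\<lambda>G. {S \<in> Pow Q. shatters G S})"
  have finF: "finite F"
    using insert.prems insert.hyps by (meson finite.insertI finite_Pow_iff finite_subset)
  have sub: "F0 \<subseteq> Pow Q" "F1 \<subseteq> Pow Q"
    using insert.prems by (auto simp: F0_def F1_def)
  have fin: "finite (Sh G)" for G
    using insert.hyps by (simp add: Sh_def)
  have "card F = card F0 + card {A \<in> F. x \<in> A}"
  proof -
    have "F = F0 \<union> {A \<in> F. x \<in> A}" by (auto simp: F0_def)
    moreover have "card (F0 \<union> {A \<in> F. x \<in> A}) = card F0 + card {A \<in> F. x \<in> A}"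
      using finF by (intro card_Un_disjoint) (auto simp: F0_def)
    ultimately show ?thesis by simp
  qed
  also have "card {A \<in> F. x \<in> A} = card F1"
    unfolding F1_def by (rule card_image[symmetric]) (auto simp: inj_on_def)
  also have "card F0 + card F1 \<le> card (Sh F0) + card (Sh F1)"
    unfolding Sh_def by (intro add_mono insert.IH sub)
  also have "\<dots> = card (Sh F0 \<union> Sh F1) + card (Sh F0 \<inter> Sh F1)"
    by (rule card_Un_Int) (rule fin)+
  also have "card (Sh F0 \<inter> Sh F1) = card (Set.insert x ` (Sh F0 \<inter> Sh F1))"
    using insert.hyps by (intro card_image[symmetric] inj_onI) (auto simp: Sh_def)
  also have "card (Sh F0 \<union> Sh F1) + \<dots> = card ((Sh F0 \<union> Sh F1) \<union> Set.insert x ` (Sh F0 \<inter> Sh F1))"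
    using insert.hyps fin by (intro card_Un_disjoint[symmetric]) (auto simp: Sh_def)
  also have "\<dots> \<le> card {S \<in> Pow (Set.insert x Q). shatters F S}"
  proof (intro card_mono)
    show "finite {S \<in> Pow (Set.insert x Q). shatters F S}"
      using insert.hyps by simp
    have up: "shatters F S" if "shatters F0 S" for S
      using that unfolding shatters_def F0_def by blast
    have up1: "shatters F S" if "shatters F1 S" "S \<subseteq> Q" for S
      unfolding shatters_def
    proof (intro allI impI)
      fix B assume "B \<subseteq> S"
      with that obtain A where "A \<in> F" "B = S \<inter> (A - {x})"
        unfolding shatters_def F1_def by blast
      with that insert.hyps show "\<exists>C\<in>F. B = S \<inter> C" by (intro bexI[of _ A]) auto
    qed
    have up2: "shatters F (Set.insert x S)" if "shatters F0 S" "shatters F1 S" for S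
      unfolding shatters_def
    proof (intro allI impI)
      fix B assume B: "B \<subseteq> Set.insert x S"
      show "\<exists>C\<in>F. B = Set.insert x S \<inter> C"
      proof (cases "x \<in> B")
        case True
        from B have "B - {x} \<subseteq> S" by auto
        with that(2) obtain A where "A \<in> F" "x \<in> A" "B - {x} = S \<inter> (A - {x})"
          unfolding shatters_def F1_def by blast
        then show ?thesis using True by (intro bexI[of _ A]) auto
      next
        case False
        with B have "B \<subseteq> S" by auto
        with that(1) obtain A where "A \<in> F" "x \<notin> A" "B = S \<inter> A"
          unfolding shatters_def F0_def by blast
        then show ?thesis using False by (intro bexI[of _ A]) auto
      qed
    qed
    show "(Sh F0 \<union> Sh F1) \<union> Set.insert x ` (Sh F0 \<inter> Sh F1) \<subseteq> {S \<in> Pow (Set.insert x Q). shatters F S}"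
      using up up1 up2 by (auto simp: Sh_def)
  qed
  finally show ?case .
qed

lemma sum_power_card_Pow:
  fixes z :: real
  assumes "finite Q"
  shows "(\<Sum>S\<in>Pow Q. z ^ card S) = (1 + z) ^ card Q"
  using assms
proof (induction Q rule: finite_induct)
  case (insert x Q)
  have "(\<Sum>S\<in>Pow (Set.insert x Q). z ^ card S)
      = (\<Sum>S\<in>Pow Q. z ^ card S) + (\<Sum>S\<in>Set.insert x ` Pow Q. z ^ card S)"
    using insert.hyps by (subst Pow_insert, intro sum.union_disjoint) auto
  also have "(\<Sum>S\<in>Set.insert x ` Pow Q. z ^ card S) = (\<Sum>S\<in>Pow Q. z ^ card (Set.insert x S))"
    using insert.hyps by (subst sum.reindex) (auto simp: inj_on_def)
  also have "\<dots> = (\<Sum>S\<in>Pow Q. z * z ^ card S)"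
    using insert.hyps by (intro sum.cong refl) (subst card_insert_disjoint, auto intro: finite_subset)
  finally show ?case
    using insert by (simp flip: sum_distrib_left add: algebra_simps)
qed simp

text \<open>
  Weighting each set \<open>S\<close> with \<open>z ^ card S\<close>, \<open>z = d / m \<le> 1\<close>, costs at most a factor \<open>z ^ d\<close> on
  sets of at most \<open>d\<close> points, while the total weight is \<open>(1 + z) ^ card Q \<le> exp d\<close>.
\<close>

lemma card_small_subsets_le:
  fixes d m :: nat
  assumes "finite Q" "card Q \<le> m" "0 < d" "d \<le> m"
  shows "real (card {S \<in> Pow Q. card S \<le> d}) \<le> (exp 1 * (m / d)) ^ d"
proof -
  define z where "z = real d / real m"
  have z: "0 < z" "z \<le> 1" using assms by (auto simp: z_def)
  have "real (card {S \<in> Pow Q. card S \<le> d}) * z ^ d = (\<Sum>S | S \<in> Pow Q \<and> card S \<le> d. z ^ d)"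
    by simp
  also have "\<dots> \<le> (\<Sum>S | S \<in> Pow Q \<and> card S \<le> d. z ^ card S)"
    using z by (intro sum_mono power_decreasing) auto
  also have "\<dots> \<le> (\<Sum>S\<in>Pow Q. z ^ card S)"
    using z assms by (intro sum_mono2) auto
  also have "\<dots> = (1 + z) ^ card Q"
    by (rule sum_power_card_Pow) fact
  also have "\<dots> \<le> (1 + z) ^ m"
    using z assms by (intro power_increasing) auto
  also have "\<dots> \<le> exp z ^ m"
    using z by (intro power_mono exp_ge_add_one_self) auto
  also have "\<dots> = exp 1 ^ d"
    using assms by (simp add: z_def flip: exp_of_nat_mult)
  finally show ?thesis
    using z assms by (simp add: z_def field_simps power_mult_distrib power_divide)
qed

lemma Sauer_Shelah:
  fixes d m :: nat
  assumes "finite Q" "F \<subseteq> Pow Q" "card Q \<le> m" "0 < d" "d \<le> m"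
    and "\<And>S. S \<subseteq> Q \<Longrightarrow> shatters F S \<Longrightarrow> card S \<le> d"
  shows "real (card F) \<le> (exp 1 * (m / d)) ^ d"
proof -
  have "card F \<le> card {S \<in> Pow Q. shatters F S}"
    by (rule card_le_card_shattered) fact+
  also have "\<dots> \<le> card {S \<in> Pow Q. card S \<le> d}"
    using assms by (intro card_mono) auto
  finally show ?thesis
    using card_small_subsets_le[OF assms(1,3,4,5)] by linarith
qed

definition unseparated :: "'a set set \<Rightarrow> 'a set \<Rightarrow> ('a set \<times> 'a set) set" where
  "unseparated T Q = {p \<in> T \<times> T. fst p \<noteq> snd p \<and> fst p \<inter> Q = snd p \<inter> Q}"

lemma finite_unseparated: "finite T \<Longrightarrow> finite (unseparated T Q)"
  unfolding unseparated_def by (rule finite_subset[of _ "T \<times> T"]) auto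

lemma unseparatedD: "p \<in> unseparated T Q \<Longrightarrow> fst p \<in> T \<and> snd p \<in> T \<and> fst p \<noteq> snd p"
  by (auto simp only: unseparated_def mem_Collect_eq mem_Times_iff)

lemma unseparated_insert:
  "unseparated T (insert i Q) = unseparated T Q - {p \<in> unseparated T Q. i \<in> sym_diff (fst p) (snd p)}"
  (is "?L = ?R")
proof (rule set_eqI)
  have "A \<inter> insert i Q = B \<inter> insert i Q \<longleftrightarrow> A \<inter> Q = B \<inter> Q \<and> i \<notin> sym_diff A B" for A B
    by blast
  then show "p \<in> ?L \<longleftrightarrow> p \<in> ?R" for p
    by (simp only: unseparated_def mem_Collect_eq Diff_iff) blast
qed

text \<open>
  The points are chosen greedily. A pair of distinct members disagrees on at least a fraction
  \<open>\<epsilon>\<close> of the points, so by averaging some point splits at least a fraction \<open>\<epsilon>\<close> of the pairs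
  that are still together; each point therefore shrinks their number by the factor \<open>1 - \<epsilon>\<close>.
\<close>

lemma exists_separating_points:
  fixes \<epsilon> :: real
  assumes "finite I" "T \<subseteq> Pow I" "0 \<le> \<epsilon>" "\<epsilon> \<le> 1"
    and sep: "\<And>A B. A \<in> T \<Longrightarrow> B \<in> T \<Longrightarrow> A \<noteq> B \<Longrightarrow> \<epsilon> * card I \<le> card (sym_diff A B)"
  shows "\<exists>Q\<subseteq>I. card Q \<le> m \<and>
    real (card (unseparated T Q)) \<le> (1 - \<epsilon>) ^ m * (real (card T))\<^sup>2"
proof -
  have finT: "finite T" using assms by (meson finite_Pow_iff finite_subset)
  show ?thesis
  proof (induction m)
    case 0
    have "card (unseparated T {}) \<le> card (T \<times> T)"
      using finT unfolding unseparated_def by (intro card_mono) auto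
    then have "real (card (unseparated T {})) \<le> (real (card T))\<^sup>2"
      unfolding card_cartesian_product power2_eq_square of_nat_mult[symmetric] of_nat_le_iff .
    then show ?case by (intro exI[of _ "{}"]) simp
  next
    case (Suc m)
    then obtain Q where Q: "Q \<subseteq> I" "card Q \<le> m"
      and le: "real (card (unseparated T Q)) \<le> (1 - \<epsilon>) ^ m * (real (card T))\<^sup>2"
      by auto
    define U where "U = unseparated T Q"
    have UD: "fst p \<in> T" "snd p \<in> T" "fst p \<noteq> snd p" if "p \<in> U" for p
      using unseparatedD[of p T Q] that by (auto simp only: U_def)
    have finU: "finite U"
      unfolding U_def using finT by (rule finite_unseparated)
    define W where "W = (\<lambda>i. {p \<in> U. i \<in> sym_diff (fst p) (snd p)})"
    show ?case
    proof (cases "U = {}")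
      case True
      then show ?thesis using Q assms
        by (intro exI[of _ Q]) (simp only: U_def[symmetric], auto)
    next
      case False
      have "(\<Sum>i\<in>I. real (card (W i))) = (\<Sum>i\<in>I. \<Sum>p\<in>U. if i \<in> sym_diff (fst p) (snd p) then 1 else 0)"
        unfolding W_def using finU by (intro sum.cong refl) (simp add: sum.If_cases Int_def)
      also have "\<dots> = (\<Sum>p\<in>U. \<Sum>i\<in>I. if i \<in> sym_diff (fst p) (snd p) then 1 else 0)"
        by (rule sum.swap)
      also have "\<dots> = (\<Sum>p\<in>U. real (card (sym_diff (fst p) (snd p))))"
      proof (rule sum.cong[OF refl])
        fix p assume "p \<in> U"
        then have "fst p \<in> T" "snd p \<in> T"
          by (simp_all add: UD)
        then have "fst p \<subseteq> I" "snd p \<subseteq> I"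
          using assms(2) by blast+
        then have *: "I \<inter> sym_diff (fst p) (snd p) = sym_diff (fst p) (snd p)"
          by blast
        have "(\<Sum>i\<in>I. if i \<in> sym_diff (fst p) (snd p) then 1 else 0 :: real)
            = (\<Sum>i\<in>I \<inter> sym_diff (fst p) (snd p). 1)"
          by (rule sum.inter_restrict[OF \<open>finite I\<close>, symmetric])
        then show "(\<Sum>i\<in>I. if i \<in> sym_diff (fst p) (snd p) then 1 else 0) = real (card (sym_diff (fst p) (snd p)))"
          unfolding * by simp
      qed
      also have "\<dots> \<ge> (\<Sum>p\<in>U. \<epsilon> * card I)"
        by (intro sum_mono sep) (simp_all add: UD)
      finally have ge: "(\<Sum>i\<in>I. \<epsilon> * card U) \<le> (\<Sum>i\<in>I. real (card (W i)))"
        by (simp add: mult_ac)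
      have "I \<noteq> {}"
      proof
        assume "I = {}"
        with assms(2) have "A = B" if "A \<in> T" "B \<in> T" for A B
          using that by blast
        with UD False show False by blast
      qed
      with ge obtain i where i: "i \<in> I" "\<epsilon> * card U \<le> card (W i)"
        using sum_strict_mono[OF \<open>finite I\<close>, of "\<lambda>i. real (card (W i))" "\<lambda>_. \<epsilon> * card U"]
        by force
      have "real (card (unseparated T (insert i Q))) = real (card (U - W i))"
        by (simp only: unseparated_insert U_def W_def)
      also have "\<dots> = real (card U) - real (card (W i))"
      proof -
        have "W i \<subseteq> U" by (simp add: W_def)
        with finU show ?thesis
          by (simp add: card_Diff_subset finite_subset card_mono of_nat_diff)
      qed
      also have "\<dots> \<le> (1 - \<epsilon>) * card U"
        using i by (simp add: algebra_simps)
      also have "\<dots> \<le> (1 - \<epsilon>) * ((1 - \<epsilon>) ^ m * (real (card T))\<^sup>2)"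
        using le assms by (intro mult_left_mono) (simp_all add: U_def)
      finally show ?thesis
        using Q i card_insert_le_m1[of "Suc m" Q i]
        by (intro exI[of _ "insert i Q"]) (simp add: mult.assoc)
    qed
  qed
qed

text \<open>
  After more than \<open>2 ln N / \<epsilon>\<close> separating points fewer than one pair is left together, so
  the \<open>N\<close> members have distinct traces on \<open>m\<close> points and the Sauer--Shelah lemma bounds \<open>N\<close> by
  \<open>(e m / d) ^ d\<close>. As \<open>m\<close> is itself of order \<open>d + ln N / \<epsilon>\<close>, this is an inequality for
  \<open>L = ln N / d\<close> of the form \<open>L \<le> const + ln (1 / \<epsilon>) + ln (1 + L)\<close>, which bounds \<open>L\<close> because
  the logarithm grows slower than \<open>L / 2\<close>.
\<close>

lemma ln_card_packing_le:
  fixes \<epsilon> :: real and d :: nat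
  assumes "finite I" "T \<subseteq> Pow I" "T \<noteq> {}" "0 < \<epsilon>" "\<epsilon> \<le> 1" "0 < d"
    and VC: "\<And>S. S \<subseteq> I \<Longrightarrow> shatters T S \<Longrightarrow> card S \<le> d"
    and sep: "\<And>A B. A \<in> T \<Longrightarrow> B \<in> T \<Longrightarrow> A \<noteq> B \<Longrightarrow> \<epsilon> * card I \<le> card (sym_diff A B)"
  shows "ln (card T) \<le> d * (1 + 4 * ln 2 + 2 * ln (1 / \<epsilon>))"
proof -
  have finT: "finite T" using assms by (meson finite_Pow_iff finite_subset)
  define N where "N = real (card T)"
  have N: "1 \<le> N" using finT \<open>T \<noteq> {}\<close> by (simp add: N_def Suc_leI card_gt_0_iff)
  define L where "L = ln N / d"
  have L: "0 \<le> L" using N by (simp add: L_def)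
  \<comment> \<open>the summand \<open>d\<close> secures \<open>d \<le> m\<close>, which the Sauer--Shelah bound needs\<close>
  define m where "m = d + nat \<lfloor>2 * ln N / \<epsilon>\<rfloor> + 1"
  have fl: "real (nat \<lfloor>2 * ln N / \<epsilon>\<rfloor>) = real_of_int \<lfloor>2 * ln N / \<epsilon>\<rfloor>"
    using N assms by simp
  have m_gt: "2 * ln N / \<epsilon> < m" and m_le: "m \<le> d + 1 + 2 * ln N / \<epsilon>"
    unfolding m_def using fl by linarith+
  have md: "0 < m" "0 < d"
    using assms by (simp_all add: m_def)
  obtain Q where Q: "Q \<subseteq> I" "card Q \<le> m"
    and le: "real (card (unseparated T Q)) \<le> (1 - \<epsilon>) ^ m * N\<^sup>2"
    using exists_separating_points[OF assms(1,2) less_imp_le[OF assms(4)] assms(5) sep, of m]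
    unfolding N_def by auto
  have "(1 - \<epsilon>) ^ m * N\<^sup>2 \<le> exp (-\<epsilon>) ^ m * N\<^sup>2"
    using assms exp_ge_add_one_self[of "-\<epsilon>"] by (intro mult_right_mono power_mono) auto
  also have "exp (-\<epsilon>) ^ m * N\<^sup>2 = exp (2 * ln N - \<epsilon> * m)"
  proof -
    have "N\<^sup>2 = exp (2 * ln N)"
      using N exp_of_nat_mult[of 2 "ln N"] by simp
    then show ?thesis
      by (simp add: exp_diff exp_minus field_simps flip: exp_of_nat_mult)
  qed
  also have "\<dots> < exp 0"
    using m_gt assms by (subst exp_less_cancel_iff) (simp add: field_simps)
  finally have "card (unseparated T Q) = 0"
    using le by simp
  moreover have "finite (unseparated T Q)"
    using finT by (rule finite_unseparated)
  ultimately have "unseparated T Q = {}" by simp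
  then have inj: "inj_on (\<lambda>A. A \<inter> Q) T"
    by (auto simp: inj_on_def unseparated_def)
  define F where "F = (\<lambda>A. A \<inter> Q) ` T"
  have "card S \<le> d" if "S \<subseteq> Q" "shatters F S" for S
  proof (rule VC)
    show "S \<subseteq> I" using that Q by auto
    show "shatters T S" unfolding shatters_def
    proof (intro allI impI)
      fix B assume "B \<subseteq> S"
      with that(2) obtain A where "A \<in> T" "B = S \<inter> (A \<inter> Q)"
        unfolding shatters_def F_def by blast
      then show "\<exists>C\<in>T. B = S \<inter> C" using that(1) by (intro bexI[of _ A]) auto
    qed
  qed
  then have "real (card F) \<le> (exp 1 * (m / d)) ^ d"
    using Q assms by (intro Sauer_Shelah[of Q]) (auto simp: F_def m_def intro: finite_subset)
  also have "card F = card T"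
    unfolding F_def by (rule card_image) fact
  finally have "ln N \<le> ln ((exp 1 * (m / d)) ^ d)"
    using N unfolding N_def by (subst ln_le_cancel_iff) auto
  also have "\<dots> = d * (1 + ln (m / d))"
  proof -
    have "ln (exp 1 * (m / d)) = 1 + ln (m / d)"
      using md by (subst ln_mult) auto
    then show ?thesis using md by (subst ln_realpow) auto
  qed
  finally have "L \<le> 1 + ln (m / d)"
    using assms by (simp add: L_def field_simps)
  also have "ln (m / d) \<le> ln (2 * ((1 + L) * (1 / \<epsilon>)))"
  proof (subst ln_le_cancel_iff)
    have "real m \<le> 2 * d + 2 * ln N / \<epsilon>" using m_le md by linarith
    then have "m / d \<le> 2 + 2 * L / \<epsilon>" using md by (simp add: L_def field_simps)
    also have "\<dots> \<le> 2 * ((1 + L) * (1 / \<epsilon>))"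
      using assms L by (simp add: field_simps)
    finally show "m / d \<le> 2 * ((1 + L) * (1 / \<epsilon>))" .
  qed (use md L assms in auto)
  also have "1 + ln (2 * ((1 + L) * (1 / \<epsilon>))) = 1 + ln 2 + ln (1 / \<epsilon>) + ln (1 + L)"
    using assms L ln_mult[of 2 "(1 + L) * (1 / \<epsilon>)"] ln_mult[of "1 + L" "1 / \<epsilon>"] by simp
  \<comment> \<open>halving the argument first lets \<open>ln y \<le> y - 1\<close> produce \<open>L / 2\<close>, absorbed on the left\<close>
  also have "ln (1 + L) = ln 2 + ln ((1 + L) / 2)"
    using L by (simp add: ln_div)
  also have "ln ((1 + L) / 2) \<le> (1 + L) / 2 - 1"
    using L by (intro ln_le_minus_one) auto
  finally have "L \<le> 1 + 4 * ln 2 + 2 * ln (1 / \<epsilon>)"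
    by (simp add: field_simps)
  then show ?thesis
    using assms by (simp add: L_def N_def field_simps)
qed

section \<open>Rademacher sums over a class of finite dimension\<close>

text \<open>
  A point of the sign cube \<open>{-1, 1}\<^sup>I\<close> is encoded by the set \<open>S\<close> of its positive coordinates, so
  that the uniform average over signs is a sum over \<open>Pow I\<close>.
\<close>

definition rademacher :: "'i set \<Rightarrow> 'i \<Rightarrow> real" where
  "rademacher S i = (if i \<in> S then 1 else -1)"

definition sign_mean :: "'i set \<Rightarrow> ('i set \<Rightarrow> real) \<Rightarrow> real" where
  "sign_mean I g = (\<Sum>S\<in>Pow I. g S) / 2 ^ card I"

lemma sign_mean_mono:
  assumes "\<And>S. S \<subseteq> I \<Longrightarrow> g S \<le> h S"
  shows "sign_mean I g \<le> sign_mean I h"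
  unfolding sign_mean_def using assms by (intro divide_right_mono sum_mono) auto

lemma sign_mean_add: "sign_mean I (\<lambda>S. g S + h S) = sign_mean I g + sign_mean I h"
  by (simp add: sign_mean_def sum.distrib add_divide_distrib)

lemma sign_mean_cmult: "sign_mean I (\<lambda>S. c * g S) = c * sign_mean I g"
  by (simp add: sign_mean_def sum_distrib_left)

lemma sign_mean_const [simp]: "finite I \<Longrightarrow> sign_mean I (\<lambda>_. c) = c"
  by (simp add: sign_mean_def card_Pow)

lemma sign_mean_sum: "sign_mean I (\<lambda>S. \<Sum>k\<in>K. g k S) = (\<Sum>k\<in>K. sign_mean I (g k))"
  by (simp add: sign_mean_def sum_divide_distrib sum.swap[of _ "Pow I"])

lemma sign_mean_cong:
  "(\<And>S. S \<subseteq> I \<Longrightarrow> g S = h S) \<Longrightarrow> sign_mean I g = sign_mean I h"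
  by (simp add: sign_mean_def)

lemma sign_mean_nonneg: "(\<And>S. S \<subseteq> I \<Longrightarrow> 0 \<le> g S) \<Longrightarrow> 0 \<le> sign_mean I g"
  unfolding sign_mean_def by (intro divide_nonneg_nonneg sum_nonneg) auto

lemma sign_mean_insert:
  assumes "finite J" "j \<notin> J"
  shows "sign_mean (Set.insert j J) g = sign_mean J (\<lambda>S. (g (Set.insert j S) + g S) / 2)"
proof -
  have "(\<Sum>S\<in>Pow (Set.insert j J). g S) = (\<Sum>S\<in>Pow J. g S) + (\<Sum>S\<in>Set.insert j ` Pow J. g S)"
    using assms by (subst Pow_insert, intro sum.union_disjoint) auto
  also have "(\<Sum>S\<in>Set.insert j ` Pow J. g S) = (\<Sum>S\<in>Pow J. g (Set.insert j S))"
    using assms by (subst sum.reindex) (auto simp: inj_on_def)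
  finally show ?thesis
    using assms by (simp add: sign_mean_def sum.distrib add_divide_distrib flip: sum_divide_distrib)
qed

text \<open>
  This is the case of a symmetric two-point distribution in Hoeffding's lemma.
\<close>

lemma cosh_le_exp_half_square: "cosh x \<le> exp (x\<^sup>2 / 2)" for x :: real
proof -
  have "exp \<bar>x\<bar> * cosh x = (1 + exp (2 * \<bar>x\<bar>)) / 2"
    by (subst cosh_real_abs[symmetric], simp add: cosh_field_def field_simps flip: exp_add)
  then have "cosh x = exp (- \<bar>x\<bar>) * (1 + 1 / 2 * (exp (2 * \<bar>x\<bar>) - 1))"
    by (simp add: exp_minus field_simps)
  also have "\<dots> = exp (- (2 * \<bar>x\<bar>) * (1 / 2) + ln (1 + 1 / 2 * (exp (2 * \<bar>x\<bar>) - 1)))"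
  proof -
    have "0 < 1 + 1 / 2 * (exp (2 * \<bar>x\<bar>) - 1)"
      by (simp add: field_simps add_pos_pos)
    then show ?thesis by (simp only: exp_add exp_ln) simp
  qed
  also have "\<dots> \<le> exp ((2 * \<bar>x\<bar>)\<^sup>2 / 8)"
    by (subst exp_le_cancel_iff, rule Hoeffdings_lemma_aux) auto
  finally show ?thesis by (simp add: power2_eq_square)
qed

lemma sign_mean_exp_le:
  assumes "finite I"
  shows "sign_mean I (\<lambda>S. exp (\<Sum>i\<in>I. rademacher S i * v i)) \<le> exp ((\<Sum>i\<in>I. (v i)\<^sup>2) / 2)"
proof -
  have eq: "exp (\<Sum>i\<in>I. rademacher S i * v i) = (\<Prod>i\<in>S. exp (v i)) * (\<Prod>i\<in>I - S. exp (- v i))"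
    if "S \<subseteq> I" for S
  proof -
    have "exp (\<Sum>i\<in>I. rademacher S i * v i) = (\<Prod>i\<in>I. exp (rademacher S i * v i))"
      using assms by (rule exp_sum)
    also have "\<dots> = (\<Prod>i\<in>I - S. exp (rademacher S i * v i)) * (\<Prod>i\<in>S. exp (rademacher S i * v i))"
      using that assms by (rule prod.subset_diff)
    finally show ?thesis by (simp add: rademacher_def)
  qed
  have "sign_mean I (\<lambda>S. exp (\<Sum>i\<in>I. rademacher S i * v i))
      = (\<Prod>i\<in>I. exp (v i) + exp (- v i)) / 2 ^ card I"
    using eq by (simp add: sign_mean_def prod_add[OF assms])
  also have "\<dots> = (\<Prod>i\<in>I. cosh (v i))"
    by (simp add: cosh_field_def prod_dividef)
  also have "\<dots> \<le> (\<Prod>i\<in>I. exp ((v i)\<^sup>2 / 2))"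
    by (intro prod_mono conjI cosh_le_exp_half_square) auto
  also have "\<dots> = exp ((\<Sum>i\<in>I. (v i)\<^sup>2) / 2)"
    using assms by (simp add: exp_sum sum_divide_distrib)
  finally show ?thesis .
qed

text \<open>
  The maximal inequality for sub-Gaussian sums. The usual bound
  \<open>exp (l E max) \<le> E exp (l max) \<le> \<Sum>\<^sub>k E exp (l \<bar>X\<^sub>k\<bar>)\<close> is used in its linearized form
  \<open>l max + 1 - c \<le> exp (l max - c)\<close>. With \<open>c = ln (2 card K) + l\<^sup>2 s / 2\<close> the right-hand side has
  mean at most \<open>1\<close>, so averaging gives \<open>l E max \<le> c\<close>. The maximum enters only through a
  function \<open>g\<close> dominated by some \<open>\<bar>X\<^sub>k\<bar>\<close> at each sign vector.
\<close>

lemma sign_mean_maximal: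
  assumes "finite I" "finite K" "K \<noteq> {}" "0 < l"
    and v: "\<And>k. k \<in> K \<Longrightarrow> (\<Sum>i\<in>I. (v k i)\<^sup>2) \<le> s"
    and g: "\<And>S. S \<subseteq> I \<Longrightarrow> \<exists>k\<in>K. g S \<le> \<bar>\<Sum>i\<in>I. rademacher S i * v k i\<bar>"
  shows "sign_mean I g \<le> ln (2 * card K) / l + l * s / 2"
proof -
  define c where "c = ln (2 * card K) + l\<^sup>2 * s / 2"
  define X where "X = (\<lambda>k S. \<Sum>i\<in>I. rademacher S i * v k i)"
  have cardK: "0 < card K" using assms by (simp add: card_gt_0_iff)
  have pt: "l * g S + (1 - c) \<le> exp (-c) * (\<Sum>k\<in>K. exp (l * X k S) + exp (-l * X k S))" if "S \<subseteq> I" for S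
  proof -
    obtain k where k: "k \<in> K" "g S \<le> \<bar>X k S\<bar>" using g[OF \<open>S \<subseteq> I\<close>] by (auto simp: X_def)
    have "l * g S + (1 - c) \<le> l * \<bar>X k S\<bar> + (1 - c)" using k assms by simp
    also have "\<dots> \<le> exp (l * \<bar>X k S\<bar> - c)"
      using exp_ge_add_one_self[of "l * \<bar>X k S\<bar> - c"] by linarith
    also have "\<dots> = exp (-c) * exp (l * \<bar>X k S\<bar>)"
      by (simp add: exp_diff exp_minus field_simps)
    also have "exp (l * \<bar>X k S\<bar>) \<le> exp (l * X k S) + exp (-l * X k S)"
      by (cases "X k S \<ge> 0") (simp_all add: less_imp_le)
    also have "\<dots> \<le> (\<Sum>k\<in>K. exp (l * X k S) + exp (-l * X k S))"
      using k assms by (intro member_le_sum) auto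
    finally show ?thesis by simp
  qed
  have mgf: "sign_mean I (\<lambda>S. exp (t * X k S)) \<le> exp (l\<^sup>2 * s / 2)" if "k \<in> K" "t\<^sup>2 = l\<^sup>2" for k t
  proof -
    have "sign_mean I (\<lambda>S. exp (t * X k S)) = sign_mean I (\<lambda>S. exp (\<Sum>i\<in>I. rademacher S i * (t * v k i)))"
      by (simp add: X_def sum_distrib_left mult_ac)
    also have "\<dots> \<le> exp ((\<Sum>i\<in>I. (t * v k i)\<^sup>2) / 2)"
      by (rule sign_mean_exp_le) fact
    also have "(\<Sum>i\<in>I. (t * v k i)\<^sup>2) = l\<^sup>2 * (\<Sum>i\<in>I. (v k i)\<^sup>2)"
      by (simp add: power_mult_distrib that(2) sum_distrib_left)
    also have "\<dots> \<le> l\<^sup>2 * s"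
      using v that by (intro mult_left_mono) auto
    finally show ?thesis by simp
  qed
  have "l * sign_mean I g + (1 - c) = sign_mean I (\<lambda>S. l * g S + (1 - c))"
    using assms by (simp add: sign_mean_add sign_mean_cmult)
  also have "\<dots> \<le> sign_mean I (\<lambda>S. exp (-c) * (\<Sum>k\<in>K. exp (l * X k S) + exp (-l * X k S)))"
    by (rule sign_mean_mono) (rule pt)
  also have "\<dots> = exp (-c) * (\<Sum>k\<in>K. sign_mean I (\<lambda>S. exp (l * X k S)) + sign_mean I (\<lambda>S. exp (-l * X k S)))"
    by (simp only: sign_mean_cmult sign_mean_sum sign_mean_add)
  also have "\<dots> \<le> exp (-c) * (\<Sum>k\<in>K. exp (l\<^sup>2 * s / 2) + exp (l\<^sup>2 * s / 2))"
    by (intro mult_left_mono sum_mono add_mono mgf) auto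
  also have "\<dots> = exp (-c) * (exp (ln (2 * card K)) * exp (l\<^sup>2 * s / 2))"
    using cardK by simp
  also have "\<dots> = 1"
    unfolding exp_add[symmetric] by (simp add: c_def)
  finally have "l * sign_mean I g \<le> c" by simp
  then have "sign_mean I g \<le> c / l" using assms by (simp add: field_simps)
  also have "\<dots> = ln (2 * card K) / l + l * s / 2"
    using assms by (simp add: c_def field_simps power2_eq_square)
  finally show ?thesis .
qed

text \<open>
  A greedy choice: a member of \<open>F\<close> joins the net only if it is far from all those chosen before.
\<close>

lemma exists_separated_net:
  fixes r :: real
  assumes "finite F" "\<And>A. A \<in> F \<Longrightarrow> \<delta> A A \<le> r" "\<And>A B. \<delta> A B = \<delta> B A"
  shows "\<exists>T\<subseteq>F. (\<forall>A\<in>T. \<forall>B\<in>T. A \<noteq> B \<longrightarrow> r < \<delta> A B) \<and> (\<forall>A\<in>F. \<exists>B\<in>T. \<delta> A B \<le> r)"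
  using assms(1,2)
proof (induction F rule: finite_induct)
  case (insert A F)
  then obtain T where T: "T \<subseteq> F" "\<forall>A\<in>T. \<forall>B\<in>T. A \<noteq> B \<longrightarrow> r < \<delta> A B" "\<forall>A\<in>F. \<exists>B\<in>T. \<delta> A B \<le> r"
    by auto
  show ?case
  proof (cases "\<exists>B\<in>T. \<delta> A B \<le> r")
    case True
    with T show ?thesis by (intro exI[of _ T]) auto
  next
    case False
    with T insert.prems assms(3) show ?thesis
      by (intro exI[of _ "Set.insert A T"]) (auto simp: not_le)
  qed
qed auto

text \<open>
  The total of the costs of the links, in units of \<open>sqrt (d n)\<close>.
\<close>

lemma sum_chaining_weights_le: "(\<Sum>k<J. (4 + real k) * (1 / 2) ^ k) \<le> (10 :: real)"
proof -
  have "(\<Sum>k<J. (4 + real k) * (1 / 2) ^ k) = (10 :: real) - (10 + 2 * J) * (1 / 2) ^ J"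
    by (induction J) (simp_all add: algebra_simps)
  then show ?thesis by simp
qed

text \<open>
  Chaining. \<open>T k\<close> is a separated net of \<open>F\<close> at Hamming radius \<open>r k = n / 4 ^ k\<close> and \<open>\<pi> k\<close> projects
  \<open>F\<close> to it. With \<open>Mx k\<close> the maximum over \<open>T k\<close> and \<open>D k\<close> the largest increment along the links
  from \<open>T (Suc k)\<close> to \<open>T k\<close>, one has \<open>Mx (Suc k) \<le> Mx k + D k\<close>. The coarsest net is a single set,
  since no two subsets of \<open>I\<close> are at distance more than \<open>n\<close>, and once \<open>r J < 1\<close> the net is all of
  \<open>F\<close>.
\<close>

lemma sign_mean_sup_le:
  fixes I :: "'i set" and d :: nat
  assumes "finite I" "I \<noteq> {}" "F \<subseteq> Pow I" "F \<noteq> {}" "0 < d"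
    and VC: "\<And>S. S \<subseteq> I \<Longrightarrow> shatters F S \<Longrightarrow> card S \<le> d"
  shows "sign_mean I (\<lambda>S. SUP A\<in>F. \<bar>\<Sum>i\<in>A. rademacher S i\<bar>) \<le> 12 * sqrt (real d * card I)"
proof -
  define n where "n = real (card I)"
  have n: "0 < n" using assms by (simp add: n_def card_gt_0_iff)
  have finF: "finite F" using assms by (meson finite_Pow_iff finite_subset)
  define X where "X = (\<lambda>(A :: 'i set) S. \<Sum>i\<in>A. rademacher S i)"
  define r where "r = (\<lambda>k::nat. (1 / 4) ^ k * n)"
  have "\<exists>T\<subseteq>F. (\<forall>A\<in>T. \<forall>B\<in>T. A \<noteq> B \<longrightarrow> r k < card (sym_diff A B)) \<and>
      (\<forall>A\<in>F. \<exists>B\<in>T. card (sym_diff A B) \<le> r k)" for k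
    using finF n by (intro exists_separated_net[where \<delta> = "\<lambda>A B. real (card (sym_diff A B))"])
      (auto simp: r_def Un_commute)
  then obtain T where T: "\<And>k. T k \<subseteq> F"
      "\<And>k A B. A \<in> T k \<Longrightarrow> B \<in> T k \<Longrightarrow> A \<noteq> B \<Longrightarrow> r k < card (sym_diff A B)"
      "\<And>k A. A \<in> F \<Longrightarrow> \<exists>B\<in>T k. card (sym_diff A B) \<le> r k"
    by metis
  define \<pi> where "\<pi> = (\<lambda>k A. SOME B. B \<in> T k \<and> card (sym_diff A B) \<le> r k)"
  have \<pi>: "\<pi> k A \<in> T k" "card (sym_diff A (\<pi> k A)) \<le> r k" if "A \<in> F" for k A
  proof -
    have "\<exists>B. B \<in> T k \<and> card (sym_diff A B) \<le> r k" using T(3)[OF that, of k] by blast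
    then have "\<pi> k A \<in> T k \<and> card (sym_diff A (\<pi> k A)) \<le> r k"
      unfolding \<pi>_def by (rule someI_ex)
    then show "\<pi> k A \<in> T k" "card (sym_diff A (\<pi> k A)) \<le> r k" by auto
  qed
  have finT: "finite (T k)" for k using T(1) finF finite_subset by blast
  have neT: "T k \<noteq> {}" for k using T(3) \<open>F \<noteq> {}\<close> by blast
  have TI: "A \<subseteq> I" if "A \<in> T k" for k A using that T(1) assms(3) by blast
  define Mx where "Mx = (\<lambda>k S. Max ((\<lambda>A. \<bar>X A S\<bar>) ` T k))"
  define D where "D = (\<lambda>k S. Max ((\<lambda>A. \<bar>X A S - X (\<pi> k A) S\<bar>) ` T (Suc k)))"
  have scale1: "real d / sqrt (d / n) = sqrt (d * n)"
  proof -
    have "real d / sqrt (d / n) = d / sqrt d * sqrt n" by (simp add: real_sqrt_divide)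
    then show ?thesis by (simp only: real_div_sqrt of_nat_0_le_iff real_sqrt_mult)
  qed
  have scale2: "sqrt (d / n) * n = sqrt (d * n)"
  proof -
    have "sqrt (d / n) * n = sqrt d * (n / sqrt n)" by (simp add: real_sqrt_divide)
    then show ?thesis using n by (simp only: real_div_sqrt less_imp_le real_sqrt_mult)
  qed
  have size: "ln (2 * card (T k)) \<le> real d * (5 + 3 * real k)" for k
  proof -
    have "ln (card (T k)) \<le> d * (1 + 4 * ln 2 + 2 * ln (1 / (1 / 4) ^ k))"
    proof (rule ln_card_packing_le[OF assms(1)])
      show "card S \<le> d" if "S \<subseteq> I" "shatters (T k) S" for S
        using VC[OF that(1) shatters_mono[OF T(1) that(2)]] .
      show "(1 / 4) ^ k * real (card I) \<le> real (card (sym_diff A B))"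
        if "A \<in> T k" "B \<in> T k" "A \<noteq> B" for A B
        using T(2)[OF that] by (simp add: r_def n_def)
    qed (use TI neT assms in \<open>auto simp: power_le_one\<close>)
    also have "ln (1 / (1 / 4) ^ k) = 2 * k * ln (2::real)"
    proof -
      have "(1 / (1 / 4) ^ k :: real) = 2 ^ (2 * k)"
        by (simp add: power_mult power_one_over)
      then show ?thesis by (simp only: ln_realpow of_nat_mult of_nat_numeral zero_less_numeral)
    qed
    finally have "ln (card (T k)) \<le> d * (1 + 4 * ln 2 + 4 * real k * ln 2)"
      by (simp add: algebra_simps)
    moreover have "ln (2 * card (T k)) = ln 2 + ln (card (T k))"
      using finT[of k] neT[of k] by (simp add: ln_mult card_gt_0_iff)
    moreover have "ln 2 \<le> d * ln (2::real)"
      using assms by simp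
    ultimately have "ln (2 * card (T k)) \<le> d * (1 + 4 * ln 2 + 4 * real k * ln 2) + d * ln 2"
      by linarith
    also have "\<dots> = d * (1 + 5 * ln 2 + 4 * real k * ln 2)"
      by (simp add: algebra_simps)
    also have "\<dots> \<le> real d * (5 + 3 * real k)"
    proof -
      have "ln 2 \<le> (3 / 4 :: real)" using ln2_le_25_over_36 by simp
      then have "4 * real k * ln 2 \<le> 4 * real k * (3 / 4)" by (intro mult_left_mono) auto
      then show ?thesis using \<open>ln 2 \<le> (3 / 4 :: real)\<close> by (intro mult_left_mono) auto
    qed
    finally show ?thesis .
  qed
  have X_eq: "X A S = (\<Sum>i\<in>I. rademacher S i * indicator A i)" if "A \<subseteq> I" for A S
    using assms(1) that unfolding X_def by (subst sum.mono_neutral_right[of I A]) (auto intro!: sum.cong)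
  have M0: "sign_mean I (Mx 0) \<le> 2 * sqrt (d * n)"
  proof -
    have "A = B" if "A \<in> T 0" "B \<in> T 0" for A B
    proof (rule ccontr)
      assume "A \<noteq> B"
      then have "n < card (sym_diff A B)" using T(2)[OF that] by (simp add: r_def)
      moreover have "card (sym_diff A B) \<le> card I"
        using TI[OF that(1)] TI[OF that(2)] assms(1) by (intro card_mono) auto
      ultimately show False by (simp add: n_def)
    qed
    then have "card (T 0) \<le> 1" using card_le_Suc0_iff_eq[OF finT] by fastforce
    then have card1: "card (T 0) = 1" using neT finT by (metis card_0_eq le_antisym less_one not_le)
    \<comment> \<open>this \<open>l\<close> balances the terms \<open>d / l\<close> and \<open>l n\<close> up to constants\<close>
    define l where "l = sqrt (d / n)"
    have l: "0 < l" using n assms by (simp add: l_def)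
    have "sign_mean I (Mx 0) \<le> ln (2 * card (T 0)) / l + l * n / 2"
    proof (rule sign_mean_maximal[where v = "\<lambda>A i. indicator A i", OF assms(1) finT neT l])
      fix A assume "A \<in> T 0"
      show "(\<Sum>i\<in>I. (indicator A i :: real)\<^sup>2) \<le> n"
        using sum_bounded_above[of I "\<lambda>i. (indicator A i :: real)\<^sup>2" 1]
        by (simp add: n_def indicator_def)
    next
      fix S
      have "Mx 0 S \<in> (\<lambda>A. \<bar>X A S\<bar>) ` T 0" unfolding Mx_def using finT neT by (intro Max_in) auto
      then show "\<exists>A\<in>T 0. Mx 0 S \<le> \<bar>\<Sum>i\<in>I. rademacher S i * indicator A i\<bar>"
        using X_eq TI by auto
    qed
    also have "ln (2 * card (T 0)) / l \<le> d / l"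
      using card1 ln2_le_25_over_36 assms l by (intro divide_right_mono) auto
    also have "d / l + l * n / 2 = 3 / 2 * sqrt (d * n)"
      unfolding l_def by (simp only: scale1 scale2)
    also have "\<dots> \<le> 2 * sqrt (d * n)" using n by simp
    finally show ?thesis by simp
  qed
  have Dk: "sign_mean I (D k) \<le> (4 + real k) * (1 / 2) ^ k * sqrt (d * n)" for k
  proof -
    \<comment> \<open>this \<open>l\<close> balances \<open>d / l\<close> and \<open>l r\<^sub>k\<close>; the factor \<open>4\<close> only improves the constant\<close>
    define l where "l = 4 * 2 ^ k * sqrt (d / n)"
    have l: "0 < l" using n assms by (simp add: l_def)
    have "sign_mean I (D k) \<le> ln (2 * card (T (Suc k))) / l + l * r k / 2"
    proof (rule sign_mean_maximal[where v = "\<lambda>A i. indicator A i - indicator (\<pi> k A) i", OF assms(1) finT neT l])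
      fix A assume A: "A \<in> T (Suc k)"
      then have "A \<in> F" using T(1) by blast
      have sub: "A \<subseteq> I" "\<pi> k A \<subseteq> I" using TI[OF A] TI \<pi>(1)[OF \<open>A \<in> F\<close>] by auto
      have "(\<Sum>i\<in>I. (indicator A i - indicator (\<pi> k A) i :: real)\<^sup>2)
          = (\<Sum>i\<in>sym_diff A (\<pi> k A). 1)"
        using sub assms(1) by (intro sum.mono_neutral_cong_right) (auto simp: indicator_def)
      then show "(\<Sum>i\<in>I. (indicator A i - indicator (\<pi> k A) i :: real)\<^sup>2) \<le> r k"
        using \<pi>(2)[OF \<open>A \<in> F\<close>, of k] by simp
    next
      fix S
      have "D k S \<in> (\<lambda>A. \<bar>X A S - X (\<pi> k A) S\<bar>) ` T (Suc k)"
        unfolding D_def using finT neT by (intro Max_in) auto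
      then obtain A where A: "A \<in> T (Suc k)" "D k S = \<bar>X A S - X (\<pi> k A) S\<bar>" by auto
      then have "A \<in> F" using T(1) by blast
      have sub: "A \<subseteq> I" "\<pi> k A \<subseteq> I" using TI[OF A(1)] TI \<pi>(1)[OF \<open>A \<in> F\<close>] by auto
      show "\<exists>A\<in>T (Suc k). D k S \<le> \<bar>\<Sum>i\<in>I. rademacher S i * (indicator A i - indicator (\<pi> k A) i)\<bar>"
        using A sub by (intro bexI[of _ A]) (simp_all add: X_eq right_diff_distrib sum_subtractf)
    qed
    also have "\<dots> \<le> real d * (8 + 3 * real k) / l + l * r k / 2"
      using size[of "Suc k"] l by (intro add_right_mono divide_right_mono) (auto simp: algebra_simps)
    also have "\<dots> = ((8 + 3 * real k) / 4 + 2) * (1 / 2) ^ k * sqrt (d * n)"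
    proof -
      have "d / l = 1 / 4 * (1 / 2) ^ k * sqrt (d * n)"
      proof -
        have "d / l = 1 / 4 * (1 / 2) ^ k * (d / sqrt (d / n))"
          by (simp add: l_def power_one_over)
        then show ?thesis by (simp only: scale1)
      qed
      moreover have "l * r k = 4 * (1 / 2) ^ k * sqrt (d * n)"
      proof -
        have "(2::real) ^ k * (1 / 4) ^ k = (1 / 2) ^ k"
          by (simp flip: power_mult_distrib)
        moreover have "l * r k = 4 * (2 ^ k * (1 / 4) ^ k) * (sqrt (d / n) * n)"
          by (simp add: l_def r_def)
        ultimately show ?thesis by (simp only: scale2)
      qed
      moreover have "real d * (8 + 3 * real k) / l = (8 + 3 * real k) * (d / l)" by simp
      ultimately show ?thesis by (simp only:) (simp add: algebra_simps)
    qed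
    also have "\<dots> \<le> (4 + real k) * (1 / 2) ^ k * sqrt (d * n)"
      using n by (intro mult_right_mono) auto
    finally show ?thesis .
  qed
  have step: "Mx (Suc k) S \<le> Mx k S + D k S" for k S
  proof -
    have "Mx (Suc k) S \<in> (\<lambda>A. \<bar>X A S\<bar>) ` T (Suc k)" unfolding Mx_def using finT neT by (intro Max_in) auto
    then obtain A where A: "A \<in> T (Suc k)" "Mx (Suc k) S = \<bar>X A S\<bar>" by auto
    then have "\<pi> k A \<in> T k" using T(1) \<pi>(1) by blast
    then have "\<bar>X (\<pi> k A) S\<bar> \<le> Mx k S" "\<bar>X A S - X (\<pi> k A) S\<bar> \<le> D k S"
      unfolding Mx_def D_def using A finT by (auto intro!: Max_ge)
    then show ?thesis using A by linarith
  qed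
  have chain: "Mx J S \<le> Mx 0 S + (\<Sum>k<J. D k S)" for J S
  proof (induction J)
    case (Suc J)
    then show ?case using step[of J S] by simp
  qed simp
  obtain J :: nat where J: "r J < 1"
  proof -
    obtain J :: nat where "(1 / 4) ^ J < 1 / n"
      using real_arch_pow_inv[of "1 / n" "1 / 4"] n by auto
    then show ?thesis using n by (intro that[of J]) (simp add: r_def field_simps)
  qed
  have top: "(SUP A\<in>F. \<bar>X A S\<bar>) \<le> Mx J S" for S
  proof (rule cSUP_least[OF \<open>F \<noteq> {}\<close>])
    fix A assume A: "A \<in> F"
    have "card (sym_diff A (\<pi> J A)) = 0" using \<pi>(2)[OF A, of J] J by simp
    moreover have "finite A" "finite (\<pi> J A)"
      using A assms(1,3) TI[OF \<pi>(1)[OF A]] by (meson PowD finite_subset subsetD)+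
    ultimately have "A = \<pi> J A" by auto
    then have "A \<in> T J" using \<pi>(1)[OF A, of J] by simp
    then show "\<bar>X A S\<bar> \<le> Mx J S" unfolding Mx_def using finT by (intro Max_ge) auto
  qed
  have "sign_mean I (\<lambda>S. SUP A\<in>F. \<bar>X A S\<bar>) \<le> sign_mean I (\<lambda>S. Mx 0 S + (\<Sum>k<J. D k S))"
    by (intro sign_mean_mono order.trans[OF top chain])
  also have "\<dots> = sign_mean I (Mx 0) + (\<Sum>k<J. sign_mean I (D k))"
    by (simp add: sign_mean_add sign_mean_sum)
  also have "\<dots> \<le> 2 * sqrt (d * n) + (\<Sum>k<J. (4 + real k) * (1 / 2) ^ k * sqrt (d * n))"
    by (intro add_mono sum_mono M0 Dk)
  also have "\<dots> = (2 + (\<Sum>k<J. (4 + real k) * (1 / 2) ^ k)) * sqrt (d * n)"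
    by (simp add: sum_distrib_right distrib_right)
  also have "\<dots> \<le> (2 + 10) * sqrt (d * n)"
    using n sum_chaining_weights_le[of J] by (intro mult_right_mono) auto
  finally show ?thesis by (simp add: X_def n_def)
qed

text \<open>
  The observations \<open>x i\<close> may coincide, so the traces are taken on indices. If the traces shatter
  a set \<open>S\<close> of indices, then \<open>x\<close> is injective on \<open>S\<close>, as coinciding observations cannot be told
  apart, and \<open>\<C>\<close> shatters its image; hence \<open>card S \<le> d\<close>.
\<close>

lemma sign_mean_class_le:
  fixes \<C> :: "'a set set" and x :: "'i \<Rightarrow> 'a" and d :: nat
  assumes "finite I" "I \<noteq> {}" "\<C> \<noteq> {}" "0 < d" "x ` I \<subseteq> X"
    and VC: "\<And>A. A \<subseteq> X \<Longrightarrow> finite A \<Longrightarrow> shatters \<C> A \<Longrightarrow> card A \<le> d"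
  shows "sign_mean I (\<lambda>S. SUP C\<in>\<C>. \<bar>\<Sum>i\<in>I. 2 * rademacher S i * indicator C (x i)\<bar>)
    \<le> 24 * sqrt (real d * card I)"
proof -
  define trace where "trace = (\<lambda>C. {i \<in> I. x i \<in> C})"
  define F where "F = trace ` \<C>"
  have F: "F \<subseteq> Pow I" "F \<noteq> {}" using assms(3) by (auto simp: F_def trace_def)
  then have finF: "finite F" using assms(1) by (meson finite_Pow_iff finite_subset)
  have "card S \<le> d" if S: "S \<subseteq> I" "shatters F S" for S
  proof -
    have tr: "\<exists>C\<in>\<C>. B = S \<inter> trace C" if "B \<subseteq> S" for B
      using S(2) that unfolding shatters_def F_def by blast
    have "inj_on x S"
    proof (rule inj_onI)
      fix i j assume ij: "i \<in> S" "j \<in> S" "x i = x j"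
      obtain C where C: "{i} = S \<inter> trace C" using tr[of "{i}"] ij by blast
      then have "i \<in> trace C" by blast
      then have "j \<in> S \<inter> trace C" using ij S(1) by (auto simp: trace_def)
      then show "i = j" unfolding C[symmetric] by simp
    qed
    then have "card S = card (x ` S)" by (simp add: card_image)
    also have "\<dots> \<le> d"
    proof (rule VC)
      show "x ` S \<subseteq> X" using S(1) assms(5) by blast
      show "finite (x ` S)" using S(1) assms(1) by (meson finite_imageI finite_subset)
      show "shatters \<C> (x ` S)" unfolding shatters_def
      proof (intro allI impI)
        fix B assume B: "B \<subseteq> x ` S"
        obtain C where C: "C \<in> \<C>" "{i \<in> S. x i \<in> B} = S \<inter> trace C"
          using tr[of "{i \<in> S. x i \<in> B}"] by blast
        have "x i \<in> B \<longleftrightarrow> x i \<in> C" if "i \<in> S" for i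
          using C(2) that S(1) by (auto simp: trace_def)
        then have "B = x ` S \<inter> C" using B by blast
        then show "\<exists>C\<in>\<C>. B = x ` S \<inter> C" using C(1) by blast
      qed
    qed
    finally show ?thesis .
  qed
  then have le: "sign_mean I (\<lambda>S. SUP A\<in>F. \<bar>\<Sum>i\<in>A. rademacher S i\<bar>) \<le> 12 * sqrt (real d * card I)"
    by (intro sign_mean_sup_le assms F)
  have "sign_mean I (\<lambda>S. SUP C\<in>\<C>. \<bar>\<Sum>i\<in>I. 2 * rademacher S i * indicator C (x i)\<bar>)
      \<le> sign_mean I (\<lambda>S. 2 * (SUP A\<in>F. \<bar>\<Sum>i\<in>A. rademacher S i\<bar>))"
  proof (intro sign_mean_mono cSUP_least[OF assms(3)])
    fix S C assume C: "C \<in> \<C>"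
    have "(\<Sum>i\<in>I. 2 * rademacher S i * indicator C (x i)) = (\<Sum>i\<in>trace C. 2 * rademacher S i)"
      using assms(1) by (intro sum.mono_neutral_cong_right) (auto simp: trace_def indicator_def)
    then have "\<bar>\<Sum>i\<in>I. 2 * rademacher S i * indicator C (x i)\<bar> = 2 * \<bar>\<Sum>i\<in>trace C. rademacher S i\<bar>"
      by (simp add: abs_mult flip: sum_distrib_left)
    also have "\<bar>\<Sum>i\<in>trace C. rademacher S i\<bar> \<le> (SUP A\<in>F. \<bar>\<Sum>i\<in>A. rademacher S i\<bar>)"
      using C finF by (intro cSUP_upper) (auto simp: F_def)
    finally show "\<bar>\<Sum>i\<in>I. 2 * rademacher S i * indicator C (x i)\<bar> \<le> 2 * (SUP A\<in>F. \<bar>\<Sum>i\<in>A. rademacher S i\<bar>)"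
      by simp
  qed
  also have "\<dots> \<le> 2 * (12 * sqrt (real d * card I))"
    unfolding sign_mean_cmult using le by (intro mult_left_mono) auto
  finally show ?thesis by simp
qed

section \<open>Symmetrization\<close>

lemma bdd_above_abs_bounded:
  fixes g :: "'k \<Rightarrow> real"
  shows "(\<And>k. k \<in> K \<Longrightarrow> \<bar>g k\<bar> \<le> B) \<Longrightarrow> bdd_above ((\<lambda>k. \<bar>g k\<bar>) ` K)"
  by (rule bdd_aboveI2)

lemma SUP_abs_nonneg:
  fixes g :: "'k \<Rightarrow> real"
  assumes "K \<noteq> {}" "\<And>k. k \<in> K \<Longrightarrow> \<bar>g k\<bar> \<le> B"
  shows "0 \<le> (SUP k\<in>K. \<bar>g k\<bar>)"
proof -
  obtain k where k: "k \<in> K" using assms by auto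
  have "0 \<le> \<bar>g k\<bar>" by simp
  also have "\<dots> \<le> (SUP k\<in>K. \<bar>g k\<bar>)"
    using k assms by (intro cSUP_upper bdd_above_abs_bounded)
  finally show ?thesis .
qed

lemma abs_SUP_abs_le:
  fixes g :: "'k \<Rightarrow> real"
  assumes "K \<noteq> {}" "\<And>k. k \<in> K \<Longrightarrow> \<bar>g k\<bar> \<le> B"
  shows "\<bar>SUP k\<in>K. \<bar>g k\<bar>\<bar> \<le> B"
  using SUP_abs_nonneg[OF assms] cSUP_least[OF assms] by simp

text \<open>
  The supremum norm is 1-Lipschitz; this gives the bounded differences of \<open>Z\<close>.
\<close>

lemma SUP_abs_diff_le:
  fixes g h :: "'k \<Rightarrow> real"
  assumes "K \<noteq> {}" "\<And>k. k \<in> K \<Longrightarrow> \<bar>g k\<bar> \<le> B" "\<And>k. k \<in> K \<Longrightarrow> \<bar>h k\<bar> \<le> B"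
    and "\<And>k. k \<in> K \<Longrightarrow> \<bar>g k - h k\<bar> \<le> c"
  shows "\<bar>(SUP k\<in>K. \<bar>g k\<bar>) - (SUP k\<in>K. \<bar>h k\<bar>)\<bar> \<le> c"
proof -
  have "(SUP k\<in>K. \<bar>g k\<bar>) \<le> (SUP k\<in>K. \<bar>h k\<bar>) + c"
    if "\<And>k. k \<in> K \<Longrightarrow> \<bar>h k\<bar> \<le> B" "\<And>k. k \<in> K \<Longrightarrow> \<bar>g k - h k\<bar> \<le> c" for g h :: "'k \<Rightarrow> real"
  proof (rule cSUP_least[OF \<open>K \<noteq> {}\<close>])
    fix k assume k: "k \<in> K"
    have "\<bar>h k\<bar> \<le> (SUP k\<in>K. \<bar>h k\<bar>)"
      using k that by (intro cSUP_upper bdd_above_abs_bounded)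
    then show "\<bar>g k\<bar> \<le> (SUP k\<in>K. \<bar>h k\<bar>) + c"
      using that(2)[OF k] by linarith
  qed
  from this[of h g] this[of g h] show ?thesis
    using assms by (simp add: abs_le_iff abs_minus_commute algebra_simps)
qed

lemma (in prob_space) integrable_SUP_abs:
  fixes g :: "'k \<Rightarrow> 'a \<Rightarrow> real"
  assumes "countable K" "K \<noteq> {}" "\<And>k. k \<in> K \<Longrightarrow> g k \<in> borel_measurable M"
    and "\<And>k x. k \<in> K \<Longrightarrow> x \<in> space M \<Longrightarrow> \<bar>g k x\<bar> \<le> B"
  shows "integrable M (\<lambda>x. SUP k\<in>K. \<bar>g k x\<bar>)"
proof (rule integrable_const_bound[where B = B])
  show "AE x in M. norm (SUP k\<in>K. \<bar>g k x\<bar>) \<le> B"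
    using assms by (intro AE_I2) (simp add: abs_SUP_abs_le)
  show "(\<lambda>x. SUP k\<in>K. \<bar>g k x\<bar>) \<in> borel_measurable M"
    using assms by (intro borel_measurable_cSUP bdd_above_abs_bounded) auto
qed

text \<open>
  One coordinate is symmetrized. Since
  \<open>a + (f x - E f) = ((a + 2 f x) + (a - 2 E f)) / 2\<close>, the triangle inequality applies inside the
  supremum, and Jensen's inequality moves the expectation out of the second half. The offset \<open>a\<close>
  stands for the contribution of the other coordinates.
\<close>

lemma (in prob_space) symmetrization_step:
  fixes f :: "'k \<Rightarrow> 'a \<Rightarrow> real"
  assumes K: "countable K" "K \<noteq> {}"
    and f: "\<And>k. k \<in> K \<Longrightarrow> f k \<in> borel_measurable M" "\<And>k x. k \<in> K \<Longrightarrow> \<bar>f k x\<bar> \<le> 1"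
    and a: "\<And>k. k \<in> K \<Longrightarrow> \<bar>a k\<bar> \<le> B"
  shows "(\<integral>x. (SUP k\<in>K. \<bar>a k + (f k x - expectation (f k))\<bar>) \<partial>M)
    \<le> (\<integral>x. ((SUP k\<in>K. \<bar>a k + 2 * f k x\<bar>) + (SUP k\<in>K. \<bar>a k - 2 * f k x\<bar>)) / 2 \<partial>M)"
proof -
  have fi: "integrable M (f k)" if "k \<in> K" for k
    using f that by (intro integrable_const_bound[where B = 1]) auto
  have b: "\<bar>a k + 2 * f k x\<bar> \<le> B + 2" "\<bar>a k - 2 * f k x\<bar> \<le> B + 2" if "k \<in> K" for k x
    using a[OF that] f(2)[OF that, of x] by linarith+
  have ef: "\<bar>expectation (f k)\<bar> \<le> 1" if "k \<in> K" for k
  proof -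
    have "\<bar>expectation (f k)\<bar> \<le> expectation (\<lambda>x. \<bar>f k x\<bar>)" by (rule integral_abs_bound)
    also have "\<dots> \<le> 1" using fi[OF that] f(2)[OF that] by (intro integral_le_const) auto
    finally show ?thesis .
  qed
  have i1: "integrable M (\<lambda>x. SUP k\<in>K. \<bar>a k + 2 * f k x\<bar>)"
    using f(1) by (intro integrable_SUP_abs[where B = "B + 2"] K b) auto
  have i2: "integrable M (\<lambda>x. SUP k\<in>K. \<bar>a k - 2 * f k x\<bar>)"
    using f(1) by (intro integrable_SUP_abs[where B = "B + 2"] K b) auto
  have i3: "integrable M (\<lambda>x. SUP k\<in>K. \<bar>a k + (f k x - expectation (f k))\<bar>)"
  proof (intro integrable_SUP_abs[where B = "B + 2"] K)
    show "\<bar>a k + (f k x - expectation (f k))\<bar> \<le> B + 2" if "k \<in> K" for k x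
      using a[OF that] f(2)[OF that, of x] ef[OF that] by linarith
  qed (use f(1) in auto)
  define e where "e = (\<integral>x. (SUP k\<in>K. \<bar>a k - 2 * f k x\<bar>) \<partial>M)"
  have e: "\<bar>a k - 2 * expectation (f k)\<bar> \<le> e" if k: "k \<in> K" for k
  proof -
    have "a k - 2 * expectation (f k) = (\<integral>x. a k - 2 * f k x \<partial>M)"
      using fi[OF k] by (simp add: prob_space)
    then have "\<bar>a k - 2 * expectation (f k)\<bar> \<le> (\<integral>x. \<bar>a k - 2 * f k x\<bar> \<partial>M)"
      using integral_abs_bound[of M "\<lambda>x. a k - 2 * f k x"] by simp
    also have "\<dots> \<le> e"
      unfolding e_def using fi[OF k] k b
      by (intro integral_mono i2 cSUP_upper bdd_above_abs_bounded) auto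
    finally show ?thesis .
  qed
  have "(\<integral>x. (SUP k\<in>K. \<bar>a k + (f k x - expectation (f k))\<bar>) \<partial>M)
      \<le> (\<integral>x. ((SUP k\<in>K. \<bar>a k + 2 * f k x\<bar>) + e) / 2 \<partial>M)"
  proof (rule integral_mono[OF i3])
    show "integrable M (\<lambda>x. ((SUP k\<in>K. \<bar>a k + 2 * f k x\<bar>) + e) / 2)"
      using i1 by simp
    fix x
    show "(SUP k\<in>K. \<bar>a k + (f k x - expectation (f k))\<bar>) \<le> ((SUP k\<in>K. \<bar>a k + 2 * f k x\<bar>) + e) / 2"
    proof (rule cSUP_least[OF K(2)])
      fix k assume k: "k \<in> K"
      have "\<bar>a k + 2 * f k x\<bar> \<le> (SUP k\<in>K. \<bar>a k + 2 * f k x\<bar>)"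
        using k b by (intro cSUP_upper bdd_above_abs_bounded)
      moreover have "\<bar>a k + (f k x - expectation (f k))\<bar> \<le> (s + e) / 2"
        if "\<bar>a k + 2 * f k x\<bar> \<le> s" for s
        using abs_le_D1[OF e[OF k]] abs_le_D2[OF e[OF k]] abs_le_D1[OF that] abs_le_D2[OF that]
        by (intro abs_leI) (simp_all add: field_simps)
      ultimately show "\<bar>a k + (f k x - expectation (f k))\<bar> \<le> ((SUP k\<in>K. \<bar>a k + 2 * f k x\<bar>) + e) / 2"
        by blast
    qed
  qed
  also have "\<dots> = (\<integral>x. ((SUP k\<in>K. \<bar>a k + 2 * f k x\<bar>) + (SUP k\<in>K. \<bar>a k - 2 * f k x\<bar>)) / 2 \<partial>M)"
    using i1 i2 by (simp add: e_def prob_space)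
  finally show ?thesis .
qed

lemma integral_sign_mean:
  assumes "\<And>S. S \<subseteq> J \<Longrightarrow> integrable M (g S)"
  shows "(\<integral>x. sign_mean J (\<lambda>S. g S x) \<partial>M) = sign_mean J (\<lambda>S. \<integral>x. g S x \<partial>M)"
    and "integrable M (\<lambda>x. sign_mean J (\<lambda>S. g S x))"
  using assms by (auto simp: sign_mean_def intro!: Bochner_Integration.integrable_sum)

text \<open>
  The coordinates are symmetrized one at a time. In the hybrid \<open>T J\<close> those in \<open>J\<close> carry random
  signs and the others are still centred; passing from \<open>J\<close> to \<open>insert j J\<close> is
  \<open>symmetrization_step\<close> in the variable \<open>x j\<close> with all other variables and signs fixed. Doubling
  the functions takes the place of the usual independent copy of the sample. Nonnegative integrals
  are used because the Fubini theorem for them asks only for measurability.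
\<close>

lemma symmetrization:
  fixes P :: "'a measure" and f :: "'k \<Rightarrow> 'a \<Rightarrow> real" and I :: "'i set"
  assumes P: "prob_space P" and K: "countable K" "K \<noteq> {}" and I: "finite I"
    and f: "\<And>k. k \<in> K \<Longrightarrow> f k \<in> borel_measurable P" "\<And>k x. k \<in> K \<Longrightarrow> \<bar>f k x\<bar> \<le> 1"
  shows "(\<integral>\<^sup>+x. ennreal (SUP k\<in>K. \<bar>\<Sum>i\<in>I. f k (x i) - (\<integral>y. f k y \<partial>P)\<bar>) \<partial>PiM I (\<lambda>_. P))
    \<le> (\<integral>\<^sup>+x. sign_mean I (\<lambda>S. SUP k\<in>K. \<bar>\<Sum>i\<in>I. 2 * rademacher S i * f k (x i)\<bar>) \<partial>PiM I (\<lambda>_. P))"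
proof -
  interpret P: prob_space P by (rule P)
  interpret product_sigma_finite "\<lambda>_::'i. P"
    by (simp add: product_sigma_finite_def P.sigma_finite_measure_axioms)
  define m where "m = (\<lambda>k. \<integral>y. f k y \<partial>P)"
  have m: "\<bar>m k\<bar> \<le> 1" if "k \<in> K" for k
  proof -
    have int: "integrable P (f k)" using f that by (intro P.integrable_const_bound[where B = 1]) auto
    have "\<bar>m k\<bar> \<le> (\<integral>y. \<bar>f k y\<bar> \<partial>P)" unfolding m_def by (rule integral_abs_bound)
    also have "\<dots> \<le> 1" using int f(2)[OF that] by (intro P.integral_le_const) auto
    finally show ?thesis .
  qed
  define hyb where "hyb = (\<lambda>J S x k. (\<Sum>i\<in>J. 2 * rademacher S i * f k (x i)) + (\<Sum>i\<in>I - J. f k (x i) - m k))"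
  define T where "T = (\<lambda>J x. sign_mean J (\<lambda>S. SUP k\<in>K. \<bar>hyb J S x k\<bar>))"
  have sum2: "\<bar>\<Sum>i\<in>J. 2 * rademacher S i * f k (x i)\<bar> \<le> 2 * card J" if "k \<in> K" for J S x k
  proof -
    have "\<bar>\<Sum>i\<in>J. 2 * rademacher S i * f k (x i)\<bar> \<le> (\<Sum>i\<in>J. \<bar>2 * rademacher S i * f k (x i)\<bar>)"
      by (rule sum_abs)
    also have "\<dots> \<le> of_nat (card J) * 2"
      using f(2)[OF that] by (intro sum_bounded_above) (simp add: rademacher_def abs_mult)
    finally show ?thesis by simp
  qed
  have sum1: "\<bar>\<Sum>i\<in>J. f k (x i) - m k\<bar> \<le> 2 * card J" if "k \<in> K" for J x k
  proof -
    have "\<bar>\<Sum>i\<in>J. f k (x i) - m k\<bar> \<le> (\<Sum>i\<in>J. \<bar>f k (x i) - m k\<bar>)"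
      by (rule sum_abs)
    also have "\<dots> \<le> of_nat (card J) * 2"
    proof (rule sum_bounded_above)
      show "\<bar>f k (x i) - m k\<bar> \<le> 2" for i
        using f(2)[OF that, of "x i"] m[OF that] by linarith
    qed
    finally show ?thesis by simp
  qed
  define B where "B = (\<lambda>J. real (2 * card J + 2 * card (I - J)))"
  have hyb_bound: "\<bar>hyb J S x k\<bar> \<le> B J" if "k \<in> K" for J S x k
    using sum2[OF that, of S x J] sum1[OF that, of x "I - J"] unfolding hyb_def B_def by linarith
  have T_nonneg: "0 \<le> T J x" for J x
    unfolding T_def by (intro sign_mean_nonneg SUP_abs_nonneg[OF K(2) hyb_bound])
  have hyb_meas: "(\<lambda>x. hyb J S x k) \<in> borel_measurable (PiM I (\<lambda>_. P))" if "k \<in> K" "J \<subseteq> I" for J S k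
  proof -
    have c: "(\<lambda>x. f k (x i)) \<in> borel_measurable (PiM I (\<lambda>_. P))" if "i \<in> I" for i
      using measurable_compose[OF measurable_component_singleton[OF that] f(1)[OF \<open>k \<in> K\<close>]] .
    show ?thesis
      unfolding hyb_def using that
      by (intro borel_measurable_add borel_measurable_sum borel_measurable_diff borel_measurable_times
          borel_measurable_const c) auto
  qed
  have T_meas: "T J \<in> borel_measurable (PiM I (\<lambda>_. P))" if "J \<subseteq> I" for J
    unfolding T_def sign_mean_def
    by (intro borel_measurable_divide borel_measurable_sum borel_measurable_cSUP K(1)
        bdd_above_abs_bounded[where B = "B J"] borel_measurable_const borel_measurable_abs
        hyb_meas hyb_bound that)
  have step: "(\<integral>\<^sup>+x. T J x \<partial>PiM I (\<lambda>_. P)) \<le> (\<integral>\<^sup>+x. T (Set.insert j J) x \<partial>PiM I (\<lambda>_. P))"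
    if J: "J \<subseteq> I" and j: "j \<in> I" "j \<notin> J" for J j
  proof -
    define I' where "I' = I - {j}"
    have I': "Set.insert j I' = I" "finite I'" "j \<notin> I'"
      using j I by (auto simp: I'_def)
    have finJ: "finite J" using J I by (rule finite_subset)
    have fold: "(\<integral>\<^sup>+x. T J x \<partial>PiM I (\<lambda>_. P)) = (\<integral>\<^sup>+x. (\<integral>\<^sup>+y. T J (x(j := y)) \<partial>P) \<partial>PiM I' (\<lambda>_. P))"
      if "J \<subseteq> I" for J
      using product_nn_integral_insert[OF I'(2,3), of "\<lambda>x. ennreal (T J x)"] T_meas[OF that] by (simp add: I'(1))
    have "(\<integral>\<^sup>+y. T J (x(j := y)) \<partial>P) \<le> (\<integral>\<^sup>+y. T (Set.insert j J) (x(j := y)) \<partial>P)" for x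
    proof -
      define a where "a = (\<lambda>S k. (\<Sum>i\<in>J. 2 * rademacher S i * f k (x i)) + (\<Sum>i\<in>I - Set.insert j J. f k (x i) - m k))"
      have a_bound: "\<bar>a S k\<bar> \<le> 2 * card J + 2 * card (I - Set.insert j J)" if "k \<in> K" for S k
        using sum2[OF that, of S x J] sum1[OF that, of x "I - Set.insert j J"] unfolding a_def by linarith
      define B' where "B' = real (2 * card J + 2 * card (I - Set.insert j J))"
      have a_B': "\<bar>a S k\<bar> \<le> B'" if "k \<in> K" for S k
        using a_bound[OF that] by (simp add: B'_def)
      have sumJ: "(\<Sum>i\<in>J. 2 * rademacher S i * f k ((x(j := y)) i)) = (\<Sum>i\<in>J. 2 * rademacher S i * f k (x i))"
        "(\<Sum>i\<in>J. 2 * rademacher (Set.insert j S) i * f k ((x(j := y)) i)) = (\<Sum>i\<in>J. 2 * rademacher S i * f k (x i))"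
        "(\<Sum>i\<in>I - Set.insert j J. f k ((x(j := y)) i) - m k) = (\<Sum>i\<in>I - Set.insert j J. f k (x i) - m k)" for S k y
        using j by (auto intro!: sum.cong simp: rademacher_def)
      have ins: "I - J = Set.insert j (I - Set.insert j J)" using j by auto
      have h0: "hyb J S (x(j := y)) k = a S k + (f k y - m k)" for S y k
        using I unfolding hyb_def ins a_def by (subst sum.insert) (simp_all add: sumJ del: fun_upd_apply, simp)
      have h1: "hyb (Set.insert j J) S (x(j := y)) k = a S k - 2 * f k y" if "S \<subseteq> J" for S y k
      proof -
        have "rademacher S j = -1" using that j(2) by (auto simp: rademacher_def)
        then show ?thesis
          unfolding hyb_def a_def sum.insert[OF finJ j(2)] sumJ by simp
      qed
      have h2: "hyb (Set.insert j J) (Set.insert j S) (x(j := y)) k = a S k + 2 * f k y" for S y k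
      proof -
        have "rademacher (Set.insert j S) j = 1" by (simp add: rademacher_def)
        then show ?thesis
          unfolding hyb_def a_def sum.insert[OF finJ j(2)] sumJ(2,3) by simp
      qed
      have b: "\<bar>a S k + (f k y - m k)\<bar> \<le> B' + 2" "\<bar>a S k + 2 * f k y\<bar> \<le> B' + 2" "\<bar>a S k - 2 * f k y\<bar> \<le> B' + 2"
        if "k \<in> K" for S k y
        using a_B'[OF that, of S] f(2)[OF that, of y] m[OF that] by linarith+
      have i0: "integrable P (\<lambda>y. SUP k\<in>K. \<bar>a S k + (f k y - m k)\<bar>)" for S
        using f(1) by (intro P.integrable_SUP_abs[where B = "B' + 2"] K b) auto
      have i1: "integrable P (\<lambda>y. SUP k\<in>K. \<bar>a S k + 2 * f k y\<bar>)" for S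
        using f(1) by (intro P.integrable_SUP_abs[where B = "B' + 2"] K b) auto
      have i2: "integrable P (\<lambda>y. SUP k\<in>K. \<bar>a S k - 2 * f k y\<bar>)" for S
        using f(1) by (intro P.integrable_SUP_abs[where B = "B' + 2"] K b) auto
      have i12: "integrable P (\<lambda>y. ((SUP k\<in>K. \<bar>a S k + 2 * f k y\<bar>) + (SUP k\<in>K. \<bar>a S k - 2 * f k y\<bar>)) / 2)" for S
        using i1 i2 by simp
      have T0: "T J (x(j := y)) = sign_mean J (\<lambda>S. SUP k\<in>K. \<bar>a S k + (f k y - m k)\<bar>)" for y
        by (simp add: T_def h0)
      have T1: "T (Set.insert j J) (x(j := y))
          = sign_mean J (\<lambda>S. ((SUP k\<in>K. \<bar>a S k + 2 * f k y\<bar>) + (SUP k\<in>K. \<bar>a S k - 2 * f k y\<bar>)) / 2)" for y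
        unfolding T_def sign_mean_insert[OF finJ j(2)]
        by (intro sign_mean_cong) (simp add: h1 h2)
      have "(\<integral>y. T J (x(j := y)) \<partial>P) = sign_mean J (\<lambda>S. \<integral>y. (SUP k\<in>K. \<bar>a S k + (f k y - m k)\<bar>) \<partial>P)"
        unfolding T0 by (rule integral_sign_mean(1)[OF i0])
      also have "\<dots> \<le> sign_mean J (\<lambda>S. \<integral>y. ((SUP k\<in>K. \<bar>a S k + 2 * f k y\<bar>) + (SUP k\<in>K. \<bar>a S k - 2 * f k y\<bar>)) / 2 \<partial>P)"
        unfolding m_def by (intro sign_mean_mono P.symmetrization_step[OF K f a_B'])
      also have "\<dots> = (\<integral>y. T (Set.insert j J) (x(j := y)) \<partial>P)"
        unfolding T1 by (rule integral_sign_mean(1)[OF i12, symmetric])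
      finally have "(\<integral>y. T J (x(j := y)) \<partial>P) \<le> (\<integral>y. T (Set.insert j J) (x(j := y)) \<partial>P)" .
      moreover have "integrable P (\<lambda>y. T J (x(j := y)))"
        unfolding T0 by (rule integral_sign_mean(2)[OF i0])
      moreover have "integrable P (\<lambda>y. T (Set.insert j J) (x(j := y)))"
        unfolding T1 by (rule integral_sign_mean(2)[OF i12])
      ultimately show ?thesis
        by (simp add: nn_integral_eq_integral T_nonneg ennreal_leI)
    qed
    then have "(\<integral>\<^sup>+x. (\<integral>\<^sup>+y. T J (x(j := y)) \<partial>P) \<partial>PiM I' (\<lambda>_. P))
        \<le> (\<integral>\<^sup>+x. (\<integral>\<^sup>+y. T (Set.insert j J) (x(j := y)) \<partial>P) \<partial>PiM I' (\<lambda>_. P))"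
      by (rule nn_integral_mono)
    then show ?thesis
      using J j by (simp add: fold)
  qed
  have "(\<integral>\<^sup>+x. T {} x \<partial>PiM I (\<lambda>_. P)) \<le> (\<integral>\<^sup>+x. T J x \<partial>PiM I (\<lambda>_. P))" if "J \<subseteq> I" for J
    using finite_subset[OF that I] that
  proof (induction J rule: finite_induct)
    case (insert j J)
    then show ?case using step[of J j] by (intro order.trans[OF insert.IH]) auto
  qed simp
  from this[of I] show ?thesis
    by (simp add: T_def hyb_def m_def sign_mean_def)
qed

section \<open>Bounded differences\<close>

text \<open>
  The martingale argument behind McDiarmid's inequality, as an induction on the set of coordinates.
  Integrating out one coordinate \<open>j\<close> costs the factor \<open>exp (l\<^sup>2 c\<^sup>2 / 8)\<close> by Hoeffding's lemma,
  because with the others fixed \<open>F\<close> ranges over an interval of length \<open>c\<close>. The partial mean \<open>h\<close>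
  that remains has bounded differences in the other coordinates and the same integral as \<open>F\<close>.
\<close>

lemma bounded_differences_exp_le:
  fixes M :: "'i \<Rightarrow> 'a measure" and F :: "('i \<Rightarrow> 'a) \<Rightarrow> real" and c :: real
  assumes M: "\<And>i. prob_space (M i)" and "finite I" "0 < l"
    and "F \<in> borel_measurable (PiM I M)"
    and "\<And>x. x \<in> space (PiM I M) \<Longrightarrow> \<bar>F x\<bar> \<le> B"
    and "\<And>x i u. x \<in> space (PiM I M) \<Longrightarrow> i \<in> I \<Longrightarrow> u \<in> space (M i) \<Longrightarrow> \<bar>F (x(i := u)) - F x\<bar> \<le> c"
  shows "(\<integral>\<^sup>+x. exp (l * F x) \<partial>PiM I M) \<le> exp (l * (\<integral>x. F x \<partial>PiM I M) + l\<^sup>2 * c\<^sup>2 * card I / 8)"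
  using assms(2,4-)
proof (induction I arbitrary: F rule: finite_induct)
  case empty
  interpret product_sigma_finite M
    using M by (simp add: product_sigma_finite_def prob_space_imp_sigma_finite)
  show ?case
    by (simp add: PiM_empty nn_integral_count_space_finite lebesgue_integral_count_space_finite)
next
  case (insert j I)
  interpret product_prob_space M UNIV
    using M by (simp add: product_prob_space_def product_prob_space_axioms_def
        product_sigma_finite_def prob_space_imp_sigma_finite)
  interpret PI: prob_space "PiM I M"
    by (rule prob_space_PiM) (rule M)
  interpret PJ: prob_space "PiM (Set.insert j I) M"
    by (rule prob_space_PiM) (rule M)
  note [measurable] = insert.prems(1)
  have upd: "x(j := y) \<in> space (PiM (Set.insert j I) M)"
    if "x \<in> space (PiM I M)" "y \<in> space (M j)" for x y
    using that by (auto simp: space_PiM PiE_def extensional_def)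
  define h where "h = (\<lambda>x. \<integral>y. F (x(j := y)) \<partial>M j)"
  have h_meas: "h \<in> borel_measurable (PiM I M)"
    unfolding h_def by measurable
  have meas_y: "(\<lambda>y. F (x(j := y))) \<in> borel_measurable (M j)" if "x \<in> space (PiM I M)" for x
    using measurable_component_update[OF that insert.hyps(2)] by measurable
  have int_y: "integrable (M j) (\<lambda>y. F (x(j := y)))" if "x \<in> space (PiM I M)" for x
    using meas_y[OF that] upd[OF that] insert.prems(2)
    by (intro M.integrable_const_bound[where B = B]) auto
  have h_bound: "\<bar>h x\<bar> \<le> B" if "x \<in> space (PiM I M)" for x
  proof -
    have "h x \<le> B"
      unfolding h_def using upd[OF that] insert.prems(2)
      by (intro M.integral_le_const int_y[OF that] AE_I2) (fastforce simp: abs_le_iff)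
    moreover have "-B \<le> h x"
      unfolding h_def using upd[OF that] insert.prems(2)
      by (intro M.integral_ge_const int_y[OF that] AE_I2) (fastforce simp: abs_le_iff)
    ultimately show ?thesis by linarith
  qed
  have h_diff: "\<bar>h (x(i := u)) - h x\<bar> \<le> c"
    if x: "x \<in> space (PiM I M)" and i: "i \<in> I" and u: "u \<in> space (M i)" for x i u
  proof -
    have x': "x(i := u) \<in> space (PiM I M)"
      using x i u by (auto simp: space_PiM PiE_def extensional_def)
    have "i \<noteq> j" using i insert.hyps by auto
    have pt: "\<bar>F (x(i := u, j := y)) - F (x(j := y))\<bar> \<le> c" if "y \<in> space (M j)" for y
      unfolding fun_upd_twist[OF \<open>i \<noteq> j\<close>, of x u y]
      by (rule insert.prems(3)[OF upd[OF x that] _ u]) (use i in simp)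
    have int: "integrable (M j) (\<lambda>y. F (x(i := u, j := y)) - F (x(j := y)))"
      by (intro Bochner_Integration.integrable_diff int_y x x')
    have eq: "h (x(i := u)) - h x = (\<integral>y. F (x(i := u, j := y)) - F (x(j := y)) \<partial>M j)"
      unfolding h_def by (intro Bochner_Integration.integral_diff[symmetric] int_y x x')
    have "h (x(i := u)) - h x \<le> c"
      unfolding eq using pt by (intro M.integral_le_const int AE_I2) (fastforce simp: abs_le_iff)
    moreover have "-c \<le> h (x(i := u)) - h x"
      unfolding eq using pt by (intro M.integral_ge_const int AE_I2) (fastforce simp: abs_le_iff)
    ultimately show ?thesis by linarith
  qed
  have inner: "(\<integral>\<^sup>+y. exp (l * F (x(j := y))) \<partial>M j) \<le> exp (l\<^sup>2 * c\<^sup>2 / 8) * ennreal (exp (l * h x))"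
    if x: "x \<in> space (PiM I M)" for x
  proof -
    define a where "a = (INF y\<in>space (M j). F (x(j := y)))"
    have bdd: "bdd_below ((\<lambda>y. F (x(j := y))) ` space (M j))"
      using insert.prems(2)[OF upd[OF x]] by (intro bdd_belowI2[of _ "-B"]) (fastforce simp: abs_le_iff)
    have "F (x(j := y)) \<in> {a..a + c}" if y: "y \<in> space (M j)" for y
    proof -
      have "a \<le> F (x(j := y))"
        unfolding a_def by (rule cINF_lower[OF bdd y])
      moreover have "F (x(j := y)) - c \<le> a"
        unfolding a_def
      proof (rule cINF_greatest)
        show "space (M j) \<noteq> {}" using y by auto
        fix z assume z: "z \<in> space (M j)"
        have "\<bar>F (x(j := z, j := y)) - F (x(j := z))\<bar> \<le> c"
          by (rule insert.prems(3)[OF upd[OF x z] insertI1 y])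
        then show "F (x(j := y)) - c \<le> F (x(j := z))"
          unfolding fun_upd_upd by linarith
      qed
      ultimately show ?thesis by simp
    qed
    then interpret H: interval_bounded_random_variable "M j" "\<lambda>y. F (x(j := y))" a "a + c"
      by unfold_locales (use meas_y[OF x] in auto)
    have "(\<integral>\<^sup>+y. exp (l * F (x(j := y))) \<partial>M j)
        = (\<integral>\<^sup>+y. ennreal (exp (l * h x)) * exp (l * (F (x(j := y)) - h x)) \<partial>M j)"
      by (intro nn_integral_cong) (simp add: right_diff_distrib flip: ennreal_mult exp_add)
    also have "\<dots> = ennreal (exp (l * h x)) * (\<integral>\<^sup>+y. exp (l * (F (x(j := y)) - h x)) \<partial>M j)"
      using meas_y[OF x] by (intro nn_integral_cmult) measurable
    also have "\<dots> \<le> ennreal (exp (l * h x)) * exp (l\<^sup>2 * c\<^sup>2 / 8)"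
      using H.Hoeffdings_lemma_nn_integral[OF \<open>0 < l\<close>] by (intro mult_left_mono) (simp_all add: h_def)
    finally show ?thesis by (simp add: mult.commute)
  qed
  have int_F: "integrable (PiM (Set.insert j I) M) F"
    using insert.prems by (intro PJ.integrable_const_bound[where B = B]) auto
  have "(\<integral>\<^sup>+x. exp (l * F x) \<partial>PiM (Set.insert j I) M) = (\<integral>\<^sup>+x. (\<integral>\<^sup>+y. exp (l * F (x(j := y))) \<partial>M j) \<partial>PiM I M)"
    by (intro product_nn_integral_insert insert.hyps) measurable
  also have "\<dots> \<le> (\<integral>\<^sup>+x. exp (l\<^sup>2 * c\<^sup>2 / 8) * ennreal (exp (l * h x)) \<partial>PiM I M)"
    by (intro nn_integral_mono inner)
  also have "\<dots> = exp (l\<^sup>2 * c\<^sup>2 / 8) * (\<integral>\<^sup>+x. exp (l * h x) \<partial>PiM I M)"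
    using h_meas by (intro nn_integral_cmult) measurable
  also have "\<dots> \<le> exp (l\<^sup>2 * c\<^sup>2 / 8) * ennreal (exp (l * (\<integral>x. h x \<partial>PiM I M) + l\<^sup>2 * c\<^sup>2 * card I / 8))"
    by (intro mult_left_mono insert.IH h_meas h_bound h_diff) auto
  also have "(\<integral>x. h x \<partial>PiM I M) = (\<integral>x. F x \<partial>PiM (Set.insert j I) M)"
    unfolding h_def by (rule product_integral_insert[OF insert.hyps int_F, symmetric])
  also have "exp (l\<^sup>2 * c\<^sup>2 / 8) * ennreal (exp (l * (\<integral>x. F x \<partial>PiM (Set.insert j I) M) + l\<^sup>2 * c\<^sup>2 * card I / 8))
      = exp (l * (\<integral>x. F x \<partial>PiM (Set.insert j I) M) + l\<^sup>2 * c\<^sup>2 * card (Set.insert j I) / 8)"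
    using insert.hyps by (simp add: algebra_simps add_divide_distrib flip: ennreal_mult exp_add)
  finally show ?case .
qed

lemma McDiarmid_inequality:
  fixes M :: "'i \<Rightarrow> 'a measure" and F :: "('i \<Rightarrow> 'a) \<Rightarrow> real" and c :: real
  assumes M: "\<And>i. prob_space (M i)" and I: "finite I" "I \<noteq> {}" and t: "0 < t" and c: "0 < c"
    and F[measurable]: "F \<in> borel_measurable (PiM I M)"
    and bound: "\<And>x. x \<in> space (PiM I M) \<Longrightarrow> \<bar>F x\<bar> \<le> B"
    and diff: "\<And>x i u. x \<in> space (PiM I M) \<Longrightarrow> i \<in> I \<Longrightarrow> u \<in> space (M i) \<Longrightarrow> \<bar>F (x(i := u)) - F x\<bar> \<le> c"
  shows "measure (PiM I M) {x \<in> space (PiM I M). F x \<ge> (\<integral>x. F x \<partial>PiM I M) + t}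
    \<le> exp (- 2 * t\<^sup>2 / (card I * c\<^sup>2))"
proof -
  interpret prob_space "PiM I M" by (rule prob_space_PiM) (rule M)
  define n where "n = real (card I)"
  have n: "0 < n" using I by (simp add: n_def card_gt_0_iff)
  define E where "E = (\<integral>x. F x \<partial>PiM I M)"
  \<comment> \<open>the minimizer of \<open>l\<^sup>2 c\<^sup>2 n / 8 - l t\<close>\<close>
  define l where "l = 4 * t / (n * c\<^sup>2)"
  have l: "0 < l" using t c n by (simp add: l_def)
  have "emeasure (PiM I M) {x \<in> space (PiM I M). F x \<ge> E + t}
      \<le> ennreal (exp (- l * (E + t))) * (\<integral>\<^sup>+x. ennreal (exp (l * F x)) * indicator (space (PiM I M)) x \<partial>PiM I M)"
    by (rule Chernoff_ineq_nn_integral_ge[OF l]) measurable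
  also have "(\<integral>\<^sup>+x. ennreal (exp (l * F x)) * indicator (space (PiM I M)) x \<partial>PiM I M) = (\<integral>\<^sup>+x. exp (l * F x) \<partial>PiM I M)"
    by (intro nn_integral_cong) auto
  also have "\<dots> \<le> exp (l * E + l\<^sup>2 * c\<^sup>2 * n / 8)"
    unfolding E_def n_def by (rule bounded_differences_exp_le[OF M I(1) l F bound diff])
  also have "ennreal (exp (- l * (E + t))) * ennreal (exp (l * E + l\<^sup>2 * c\<^sup>2 * n / 8)) = exp (l\<^sup>2 * c\<^sup>2 * n / 8 - l * t)"
    by (simp add: algebra_simps flip: ennreal_mult exp_add)
  also have "l\<^sup>2 * c\<^sup>2 * n / 8 - l * t = - 2 * t\<^sup>2 / (n * c\<^sup>2)"
    using n c by (simp add: l_def field_simps power2_eq_square)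
  finally show ?thesis
    unfolding E_def n_def emeasure_eq_measure by (simp add: mult_left_mono)
qed

section \<open>The deviation inequality\<close>

theorem corollary1:
  fixes M :: "'w measure" and N :: "'a measure" and P :: "'a measure"
    and \<xi> :: "nat \<Rightarrow> 'w \<Rightarrow> 'a" and \<C> :: "'a set set" and n d :: nat
    and Z :: "'w \<Rightarrow> real" and x :: real
  assumes "prob_space M"
    and "prob_space.indep_vars M (\<lambda>_. N) \<xi> {1..n}"
    and "\<And>i. i \<in> {1..n} \<Longrightarrow> distr M N (\<xi> i) = P"
    and "\<C> \<subseteq> sets N"
    and "countable \<C>"
    and "VC_class_of_index (space N) \<C> d"
    and "d \<ge> 1"
    and "n \<ge> d"
    and "\<And>\<omega>. Z \<omega> = (SUP C\<in>\<C>. \<bar>\<Sum>i=1..n. (indicator C (\<xi> i \<omega>) - measure P C)\<bar>)"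
    and "x > 0"
  shows "measure M {\<omega> \<in> space M. Z \<omega> \<ge> 2052 * sqrt (real d * real n) + 2 * sqrt (real n * x) + 3203 * x}
    \<le> 2 * exp (- x)"
proof -
  interpret M: prob_space M by fact
  define I where "I = {1..n}"
  have I: "finite I" "I \<noteq> {}" "card I = n" and n: "0 < n"
    using \<open>d \<ge> 1\<close> \<open>n \<ge> d\<close> by (auto simp: I_def)
  have rv: "\<xi> i \<in> measurable M N" if "i \<in> I" for i
    using assms(2) that by (auto simp: M.indep_vars_def I_def)
  have distr: "distr M N (\<xi> i) = P" if "i \<in> I" for i
    using assms(3) that by (simp add: I_def)
  obtain i0 where i0: "i0 \<in> I" using I by auto
  have P: "prob_space P"
    using M.prob_space_distr[OF rv[OF i0]] distr[OF i0] by simp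
  interpret P: prob_space P by (rule P)
  have sets_P [measurable_cong]: "sets P = sets N"
    using distr[OF i0] by (metis sets_distr)
  then have space_P: "space P = space N" by (rule sets_eq_imp_space_eq)
  have VC: "card A \<le> d" if "A \<subseteq> space N" "finite A" "shatters \<C> A" for A
    using assms(6) that unfolding VC_class_of_index_def by blast
  obtain A where "shatters \<C> A"
    using assms(6) unfolding VC_class_of_index_def by blast
  then have C_ne: "\<C> \<noteq> {}" unfolding shatters_def by blast
  have CP: "C \<in> sets P" if "C \<in> \<C>" for C
    using assms(4) that sets_P by auto
  define Q where "Q = PiM I (\<lambda>_. P)"
  interpret Q: prob_space Q unfolding Q_def by (rule prob_space_PiM) (rule P)
  define g where "g = (\<lambda>y C. \<Sum>i\<in>I. indicator C (y i) - measure P C :: real)"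
  define F where "F = (\<lambda>y. SUP C\<in>\<C>. \<bar>g y C\<bar>)"
  have g_bound: "\<bar>g y C\<bar> \<le> n" for y C
  proof -
    have "\<bar>g y C\<bar> \<le> (\<Sum>i\<in>I. \<bar>indicator C (y i) - measure P C\<bar>)"
      unfolding g_def by (rule sum_abs)
    also have "\<dots> \<le> of_nat (card I) * 1"
    proof (rule sum_bounded_above)
      show "\<bar>indicator C (y i) - measure P C\<bar> \<le> 1" for i
        using measure_nonneg[of P C] P.prob_le_1[of C] by (cases "y i \<in> C") auto
    qed
    finally show ?thesis using I by simp
  qed
  have g_meas: "(\<lambda>y. g y C) \<in> borel_measurable Q" if "C \<in> \<C>" for C
    using CP[OF that] unfolding g_def Q_def by measurable
  have F_meas: "F \<in> borel_measurable Q"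
    unfolding F_def using g_meas g_bound assms(5)
    by (intro borel_measurable_cSUP bdd_above_abs_bounded) auto
  have F_bound: "\<bar>F y\<bar> \<le> n" for y
    unfolding F_def by (rule abs_SUP_abs_le[OF C_ne g_bound])
  have F_nonneg: "0 \<le> F y" for y
    unfolding F_def by (rule SUP_abs_nonneg[OF C_ne g_bound])
  have F_diff: "\<bar>F (y(i := u)) - F y\<bar> \<le> 1" if i: "i \<in> I" for y i u
    unfolding F_def
  proof (rule SUP_abs_diff_le[OF C_ne g_bound g_bound])
    fix C
    have "g (y(i := u)) C - g y C = (\<Sum>k\<in>I. if k = i then indicator C u - indicator C (y i) else 0)"
      unfolding g_def sum_subtractf[symmetric] by (intro sum.cong) auto
    also have "\<dots> = indicator C u - indicator C (y i)"
      using i I by simp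
    finally show "\<bar>g (y(i := u)) C - g y C\<bar> \<le> 1"
      by (simp add: indicator_def)
  qed
  have F_int: "integrable Q F"
    using F_bound F_meas by (intro Q.integrable_const_bound[where B = n]) auto
  have mean: "(\<integral>y. F y \<partial>Q) \<le> 24 * sqrt (real d * n)"
  proof -
    have "ennreal (\<integral>y. F y \<partial>Q) = (\<integral>\<^sup>+y. F y \<partial>Q)"
      using F_int F_nonneg by (intro nn_integral_eq_integral[symmetric]) auto
    also have "\<dots> = (\<integral>\<^sup>+y. ennreal (SUP C\<in>\<C>. \<bar>\<Sum>i\<in>I. indicator C (y i) - (\<integral>z. indicator C z \<partial>P)\<bar>) \<partial>Q)"
      unfolding F_def g_def using CP by (intro nn_integral_cong arg_cong[where f = ennreal] SUP_cong refl) simp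
    also have "\<dots> \<le> (\<integral>\<^sup>+y. sign_mean I (\<lambda>S. SUP C\<in>\<C>. \<bar>\<Sum>i\<in>I. 2 * rademacher S i * indicator C (y i)\<bar>) \<partial>Q)"
      unfolding Q_def using CP I
      by (intro symmetrization P assms(5) C_ne) (auto simp: indicator_def)
    also have "\<dots> \<le> (\<integral>\<^sup>+y. ennreal (24 * sqrt (real d * n)) \<partial>Q)"
    proof (intro nn_integral_mono ennreal_leI)
      fix y assume "y \<in> space Q"
      then have "y ` I \<subseteq> space N"
        by (auto simp: Q_def space_PiM space_P)
      then show "sign_mean I (\<lambda>S. SUP C\<in>\<C>. \<bar>\<Sum>i\<in>I. 2 * rademacher S i * indicator C (y i)\<bar>) \<le> 24 * sqrt (real d * n)"
        using sign_mean_class_le[OF I(1,2) C_ne _ _ VC, of y] \<open>d \<ge> 1\<close> I(3) by simp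
    qed
    also have "\<dots> = ennreal (24 * sqrt (real d * n))"
      by (simp add: Q.emeasure_space_1)
    finally show ?thesis by (simp add: ennreal_le_iff)
  qed
  define t where "t = 2 * sqrt (n * x)"
  have t: "0 < t" using n assms(10) by (simp add: t_def)
  have "measure Q {y \<in> space Q. F y \<ge> (\<integral>y. F y \<partial>Q) + t} \<le> exp (- 2 * t\<^sup>2 / (real (card I) * 1\<^sup>2))"
    unfolding Q_def
    by (rule McDiarmid_inequality[OF P I(1,2) t _ F_meas[unfolded Q_def] F_bound F_diff]) auto
  also have "- 2 * t\<^sup>2 / (real (card I) * 1\<^sup>2) = - 8 * x"
    using n assms(10) by (simp add: t_def I(3) power_mult_distrib)
  finally have tail: "measure Q {y \<in> space Q. F y \<ge> (\<integral>y. F y \<partial>Q) + t} \<le> exp (- 8 * x)" .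
  define X where "X = (\<lambda>\<omega>. \<lambda>i\<in>I. \<xi> i \<omega>)"
  have X_PiM: "X \<in> measurable M (PiM I (\<lambda>_. N))"
    unfolding X_def by (intro measurable_restrict rv)
  have sets_Q: "sets (PiM I (\<lambda>_. N)) = sets Q"
    unfolding Q_def by (intro sets_PiM_cong) (simp_all add: sets_P)
  have X: "X \<in> measurable M Q"
    using X_PiM by (simp cong: measurable_cong_sets add: measurable_cong_sets[OF refl sets_Q])
  have "distr M (PiM I (\<lambda>_. N)) X = PiM I (\<lambda>i. distr M N (\<xi> i))"
    unfolding X_def
    using M.indep_vars_iff_distr_eq_PiM'[OF I(2), where M' = "\<lambda>_. N" and X = \<xi>] rv assms(2) by (simp add: I_def)
  also have "\<dots> = Q"
    unfolding Q_def by (intro PiM_cong) (simp_all add: distr)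
  finally have distr_X: "distr M Q X = Q"
    using distr_cong[OF refl sets_Q[symmetric], of M X X] by simp
  have Z: "Z \<omega> = F (X \<omega>)" for \<omega>
    unfolding assms(9) F_def g_def X_def I_def[symmetric]
    by (intro SUP_cong refl arg_cong[where f = abs] sum.cong) simp
  define E where "E = {y \<in> space Q. F y \<ge> (\<integral>y. F y \<partial>Q) + t}"
  have E: "E \<in> sets Q" unfolding E_def using F_meas by measurable
  have "measure M {\<omega> \<in> space M. Z \<omega> \<ge> 2052 * sqrt (real d * real n) + 2 * sqrt (real n * x) + 3203 * x}
      \<le> measure M (X -` E \<inter> space M)"
  proof (rule M.finite_measure_mono)
    show "X -` E \<inter> space M \<in> sets M" using X E by (rule measurable_sets)
    have "24 * sqrt (real d * n) \<le> 2052 * sqrt (real d * n)"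
      by (intro mult_right_mono) auto
    then have "(\<integral>y. F y \<partial>Q) + t \<le> 2052 * sqrt (real d * real n) + 2 * sqrt (real n * x) + 3203 * x"
      using mean assms(10) unfolding t_def by linarith
    then show "{\<omega> \<in> space M. Z \<omega> \<ge> 2052 * sqrt (real d * real n) + 2 * sqrt (real n * x) + 3203 * x}
        \<subseteq> X -` E \<inter> space M"
      using measurable_space[OF X] by (auto simp: E_def Z)
  qed
  also have "\<dots> = measure Q E"
    using measure_distr[OF X E] by (simp add: distr_X)
  also have "\<dots> \<le> exp (- 8 * x)"
    unfolding E_def by (rule tail)
  also have "\<dots> \<le> exp (- x)"
    using assms(10) by simp
  also have "\<dots> \<le> 2 * exp (- x)" by simp
  finally show ?thesis .
qed

end
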